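(* Let $f_0:\mathbb{N}\to\mathbb{R}$ satisfy $f_0(i)\ge 0$ for all $i\in\mathbb{N}$ and $m_\kappa\langle f_0\rangle<\infty$ for a fixed $\kappa>\max\{\delta,1,2-\alpha_1-\beta_1\}$, and let $f(t)$ be the solution of the discrete equation $\frac{\partial f}{\partial t}=O[f]$ with initial data $f_0$. Then, for any $k>1$ and for all $t>0$, $$m_k\langle f(t)\rangle\le\Bigl(\frac{2(k-1)}{\delta\,t}\Bigr)^{\frac{k-1}{\delta}}m_1\langle f_0\rangle+\mathcal{B}_k\bigl(m_1\langle f_0\rangle\bigr).$$
   Context: $\mathbb{N}=\{1,2,3,\dots\}$. Fix a mesh size $h>0$ and positive real parameters $\alpha_n,\beta_n$ ($n\in\{1,2,3\}$) and $\delta$ with $\delta>\max_{n\in\{1,2,3\}}(\alpha_n+\beta_n)$ and $\delta>2\alpha_1+\beta_1-1$. For $x,y\ge 0$ let $K_n(x,y)=x^{\alpha_n}y^{\alpha_n}(x+y)^{\beta_n}$ and $\gamma(x)=x^\delta$. For $f:\mathbb{N}\to\mathbb{R}$ and $i\in\mathbb{N}$ set $$S^{(1)}_i[f]=\sum_{j=1}^{i-1}K_1(jh,(i-j)h)f_jf_{i-j}-2\sum_{j=1}^\infty K_1(ih,jh)f_if_j,$$ and for $n\in\{2,3\}$ $$S^{(n)}_i[f]=-\sum_{j=1}^{i-1}K_n((i-j)h,jh)f_if_j+\sum_{j=i+1}^\infty K_n((j-i)h,ih)f_if_j+\sum_{j=i+1}^\infty K_n(ih,(j-i)h)f_jf_{j-i},$$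 $V_i[f]=\gamma(ih)f_i$, $S[f]=S^{(1)}[f]+S^{(2)}[f]+S^{(3)}[f]$, and $O[f]=S[f]-V[f]$. The moments are $m_k\langle f\rangle=\sum_{i=1}^\infty f_i\,(ih)^k$, $k\ge 0$. For $k>1$ define $\mathcal{B}_k:[0,\infty)\to[0,\infty)$ by $$\mathcal{B}_k(x)=\Bigl(2\,\mathcal{C}_k\,x^{1+\frac{\delta+k-1}{\delta-2\alpha_1-\beta_1+1}+\frac{\delta}{k-1}}\Bigr)^{\frac{k-1}{\delta+k-1}},$$ where $\mathcal{C}_k$ is a positive constant depending on $\alpha_1,\beta_1,\delta$ and $k$, with the explicit expression $$\mathcal{C}_k=\frac{\delta-2\alpha_1-\beta_1+1}{\delta+k-1}\bigl[2^{\beta_1+1}(2^k-2)\bigr]^{\frac{\delta+k-1}{\delta-2\alpha_1-\beta_1+1}}\Bigl(\frac{2(2\alpha_1+\beta_1+k-2)}{\delta+k-1}\Bigr)^{\frac{2\alpha_1+\beta_1+k-2}{\delta-2\alpha_1-\beta_1+1}}.$$ "The solution" with initial datum $f_0$ means the unique global classical solution $f\in C^1([0,\infty);\ell^1(\mathbb{N}))$ of $\frac{\partial f}{\partial t}=O[f]$, $f(0)=f_0$, which for all $t\ge0$ satisfies $f(t,i)\ge0$, $m_1\langle f(t)\rangle\le m_1\langle f_0\rangle$ and $m_\kappa\langle f(t)\rangle\le\max\{m_\kappa\langle f_0\rangle,2\mathcal{B}_\kappa(m_1\langle f_0\rangle)\}$ (the paper's well-posedness theorem gives existence and uniqueness)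.
   Formalization: When 2α_1+β_1+k<2 the last factor of C_k has a negative base and is in general not a real power; there the base is replaced by its absolute value, so that C_k is positive for every k>1. When 2α_1+β_1+k=2 the factor 0^0 is read as 1. *)

theory Defs
  imports "HOL-Analysis.Analysis"
begin

text \<open>
  Functions on the positive integers are represented by functions \<open>nat \<Rightarrow> real\<close> whose value at
  \<open>0\<close> is never used: every sum below runs over indices that are at least \<open>1\<close>.
  Infinite sums are unordered sums of reals, with default value \<open>0\<close> if they do not converge;
  hence finiteness of a moment is always stated separately.
\<close>

definition kern :: "real \<Rightarrow> real \<Rightarrow> real \<Rightarrow> real \<Rightarrow> real" where
  "kern a b x y = x powr a * y powr a * (x + y) powr b"

definition S_merge :: "real \<Rightarrow> real \<Rightarrow> real \<Rightarrow> (nat \<Rightarrow> real) \<Rightarrow> nat \<Rightarrow> real" where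
  "S_merge h a b f i =
     (\<Sum>j\<in>{1..<i}. kern a b (real j * h) (real (i - j) * h) * f j * f (i - j))
     - 2 * (\<Sum>\<^sub>\<infinity>j\<in>{1..}. kern a b (real i * h) (real j * h) * f i * f j)"

definition S_split :: "real \<Rightarrow> real \<Rightarrow> real \<Rightarrow> (nat \<Rightarrow> real) \<Rightarrow> nat \<Rightarrow> real" where
  "S_split h a b f i =
     - (\<Sum>j\<in>{1..<i}. kern a b (real (i - j) * h) (real j * h) * f i * f j)
     + (\<Sum>\<^sub>\<infinity>j\<in>{i<..}. kern a b (real (j - i) * h) (real i * h) * f i * f j)
     + (\<Sum>\<^sub>\<infinity>j\<in>{i<..}. kern a b (real i * h) (real (j - i) * h) * f j * f (j - i))"

definition S_op ::
  "real \<Rightarrow> (nat \<Rightarrow> real) \<Rightarrow> (nat \<Rightarrow> real) \<Rightarrow> (nat \<Rightarrow> real) \<Rightarrow> nat \<Rightarrow> real" where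
  "S_op h \<alpha> \<beta> f i =
     S_merge h (\<alpha> 1) (\<beta> 1) f i + S_split h (\<alpha> 2) (\<beta> 2) f i + S_split h (\<alpha> 3) (\<beta> 3) f i"

definition V_op :: "real \<Rightarrow> real \<Rightarrow> (nat \<Rightarrow> real) \<Rightarrow> nat \<Rightarrow> real" where
  "V_op h \<delta> f i = (real i * h) powr \<delta> * f i"

definition O_op ::
  "real \<Rightarrow> (nat \<Rightarrow> real) \<Rightarrow> (nat \<Rightarrow> real) \<Rightarrow> real \<Rightarrow> (nat \<Rightarrow> real) \<Rightarrow> nat \<Rightarrow> real" where
  "O_op h \<alpha> \<beta> \<delta> f i = S_op h \<alpha> \<beta> f i - V_op h \<delta> f i"

definition moment :: "real \<Rightarrow> real \<Rightarrow> (nat \<Rightarrow> real) \<Rightarrow> real" where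
  "moment h k f = (\<Sum>\<^sub>\<infinity>i\<in>{1..}. f i * (real i * h) powr k)"

definition finite_moment :: "real \<Rightarrow> real \<Rightarrow> (nat \<Rightarrow> real) \<Rightarrow> bool" where
  "finite_moment h k f \<longleftrightarrow> (\<lambda>i. f i * (real i * h) powr k) summable_on {1..}"

text \<open>
  In \<open>C_const\<close> the power \<open>0\<^sup>0\<close> occurs exactly if \<open>2 * a + b + k - 2 = 0\<close>; it is read as \<open>1\<close>,
  whereas \<open>0 powr 0 = 0\<close>. If \<open>2 * a + b + k - 2 < 0\<close>, the last factor has a negative base, for which
  \<open>powr\<close> on the reals takes the absolute value: \<open>x powr y = \<bar>x\<bar> powr y\<close>. So \<open>C_const\<close> is positive
  for all \<open>k > 1\<close> if \<open>\<delta> > 0\<close> and \<open>\<delta> > 2 * a + b - 1\<close>.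
\<close>

definition C_const :: "real \<Rightarrow> real \<Rightarrow> real \<Rightarrow> real \<Rightarrow> real" where
  "C_const a b \<delta> k =
     (\<delta> - 2 * a - b + 1) / (\<delta> + k - 1)
     * (2 powr (b + 1) * (2 powr k - 2)) powr ((\<delta> + k - 1) / (\<delta> - 2 * a - b + 1))
     * (if 2 * a + b + k - 2 = 0 then 1
        else (2 * (2 * a + b + k - 2) / (\<delta> + k - 1))
               powr ((2 * a + b + k - 2) / (\<delta> - 2 * a - b + 1)))"

definition B_fun :: "real \<Rightarrow> real \<Rightarrow> real \<Rightarrow> real \<Rightarrow> real \<Rightarrow> real" where
  "B_fun a b \<delta> k x =
     (2 * C_const a b \<delta> k
        * x powr (1 + (\<delta> + k - 1) / (\<delta> - 2 * a - b + 1) + \<delta> / (k - 1)))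
     powr ((k - 1) / (\<delta> + k - 1))"

definition l1 :: "(nat \<Rightarrow> real) set" where
  "l1 = {u. (\<lambda>i. \<bar>u i\<bar>) summable_on {1..}}"

definition l1_norm :: "(nat \<Rightarrow> real) \<Rightarrow> real" where
  "l1_norm u = (\<Sum>\<^sub>\<infinity>i\<in>{1..}. \<bar>u i\<bar>)"

text \<open>
  \<open>f\<close> is continuously differentiable from \<open>[0, \<infinity>)\<close> to \<open>l1\<close> with derivative \<open>f'\<close>; difference
  quotients and limits are taken in the norm of \<open>l1\<close> and are one-sided at \<open>0\<close>. Continuity of \<open>f\<close>
  itself follows from differentiability.
\<close>

definition C1_l1 :: "(real \<Rightarrow> nat \<Rightarrow> real) \<Rightarrow> (real \<Rightarrow> nat \<Rightarrow> real) \<Rightarrow> bool" where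
  "C1_l1 f f' \<longleftrightarrow>
     (\<forall>t\<ge>0. f t \<in> l1 \<and> f' t \<in> l1
        \<and> ((\<lambda>s. l1_norm (\<lambda>i. (f s i - f t i) / (s - t) - f' t i)) \<longlongrightarrow> 0) (at t within {0..})
        \<and> ((\<lambda>s. l1_norm (\<lambda>i. f' s i - f' t i)) \<longlongrightarrow> 0) (at t within {0..}))"

text \<open>
  If \<open>\<alpha> n + \<beta> n < \<delta> < \<kappa>\<close>, then nonnegativity and the finite moment of order \<open>\<kappa>\<close> make all infinite
  sums in \<open>O_op h \<alpha> \<beta> \<delta> (f t)\<close> converge.
\<close>

definition is_solution ::
  "real \<Rightarrow> (nat \<Rightarrow> real) \<Rightarrow> (nat \<Rightarrow> real) \<Rightarrow> real \<Rightarrow> real \<Rightarrow> (nat \<Rightarrow> real)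
     \<Rightarrow> (real \<Rightarrow> nat \<Rightarrow> real) \<Rightarrow> bool" where
  "is_solution h \<alpha> \<beta> \<delta> \<kappa> f0 f \<longleftrightarrow>
     C1_l1 f (\<lambda>t. O_op h \<alpha> \<beta> \<delta> (f t))
     \<and> (\<forall>i\<ge>1. f 0 i = f0 i)
     \<and> (\<forall>t\<ge>0.
          (\<forall>i\<ge>1. 0 \<le> f t i)
          \<and> finite_moment h 1 (f t) \<and> moment h 1 (f t) \<le> moment h 1 f0
          \<and> finite_moment h \<kappa> (f t)
          \<and> moment h \<kappa> (f t)
              \<le> max (moment h \<kappa> f0) (2 * B_fun (\<alpha> 1) (\<beta> 1) \<delta> \<kappa> (moment h 1 f0)))"

end

theory Submission
  imports Defs
begin

text \<open>
  Let \<open>X\<close> be the initial first moment and \<open>r = \<delta> / (k - 1)\<close>. Instead of \<open>x\<^sup>k\<close>, test the equation with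
  \<open>\<phi>(x) = x max(x, a)\<^sup>k\<^sup>-\<^sup>1\<close> for a suitable threshold \<open>a\<close>, frozen at its value at \<open>N h\<close> for larger sizes.
  Splitting contributes nothing positive below size \<open>N h\<close>, since \<open>\<phi>\<close> is superadditive; beyond that size its
  contribution is absorbed by half of the loss term, since \<open>\<delta> > \<alpha>\<^sub>n + \<beta>\<^sub>n\<close>. The gain from merging is
  at most half of the loss plus a multiple of \<open>X\<close>, by a pointwise bound on
  \<open>K\<^sub>1(x, y) (\<phi>(x + y) - \<phi>(x) - \<phi>(y))\<close>. Jensen's inequality then gives
  \<open>u' \<le> (\<beta>\<^sup>1\<^sup>+\<^sup>r - u\<^sup>1\<^sup>+\<^sup>r) / 2\<close> for the test moment \<open>u\<close> divided by \<open>X\<close>, where \<open>\<beta> = \<B>\<^sub>k(X) / X\<close>, and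
  integration of this inequality bounds the truncated moments uniformly in \<open>N\<close>. The truncation at \<open>a\<close>
  matters for \<open>1 < k < 2\<close>: then \<open>(x + y)\<^sup>k - x\<^sup>k - y\<^sup>k \<le> (2\<^sup>k - 2) x\<^sup>k\<^sup>-\<^sup>1 y\<close> fails for \<open>y \<le> x\<close>, and
  the moment of order \<open>2\<alpha>\<^sub>1 + \<beta>\<^sub>1 + k - 1\<close> may have order less than \<open>1\<close>.
\<close>

section \<open>Inequalities for real powers\<close>

text \<open>Pure powers and \<open>test_fun\<close> both have the form \<open>x * \<psi> x\<close>
  with \<psi> nondecreasing, so both inherit superadditivity from here.\<close>

lemma superadditive_mult_mono:
  fixes \<psi> :: "real \<Rightarrow> real"
  assumes "x \<ge> 0" "y \<ge> 0" "\<psi> x \<le> \<psi> (x + y)" "\<psi> y \<le> \<psi> (x + y)"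
  shows "x * \<psi> x + y * \<psi> y \<le> (x + y) * \<psi> (x + y)"
  using mult_left_mono[OF assms(3,1)] mult_left_mono[OF assms(4,2)] by (simp add: distrib_right)

lemma powr_superadditive:
  fixes x y p :: real
  assumes "x \<ge> 0" "y \<ge> 0" "p \<ge> 1"
  shows "x powr p + y powr p \<le> (x + y) powr p"
  using superadditive_mult_mono[of x y "\<lambda>x. x powr (p - 1)"] assms
  by (simp add: powr_mult_base powr_mono2)

text \<open>The left-hand side is the tangent at \<open>v\<close> of the convex function
  \<open>u powr (1 + r)\<close>. Summed over sizes with a fixed \<open>v\<close>, it does the work
  of Jensen's inequality in \<open>weighted_operator_le\<close>.\<close>

lemma powr_ge_tangent:
  fixes u v r :: real
  assumes "u \<ge> 0" "v \<ge> 0" "r > 0"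
  shows "(1 + r) * v powr r * u - r * v powr (1 + r) \<le> u powr (1 + r)"
proof -
  have "1 / (1 + r) + 1 / ((1 + r) / r) = 1" "(1 + r) / r > 1"
    using assms(3) by (simp_all add: field_simps)
  from Youngs_inequality[OF _ this(2,1), of u "v powr r"] assms
  have "u * v powr r \<le> u powr (1 + r) / (1 + r) + v powr (1 + r) / ((1 + r) / r)"
    by (simp add: powr_powr)
  also have "\<dots> = (u powr (1 + r) + r * v powr (1 + r)) / (1 + r)"
    unfolding divide_divide_eq_right by (simp add: add_divide_distrib mult.commute)
  finally show ?thesis
    using assms(3) by (simp add: field_simps)
qed

section \<open>Upper bounds for \<open>(x + y) powr k - x powr k - y powr k\<close>\<close>

text \<open>For \<open>k \<ge> 2\<close> the function \<open>(1 + s) powr k - s powr k\<close> is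
  convex on the unit interval, and the claim bounds it by its chord between \<open>0\<close> and
  \<open>1\<close>. Convexity enters by comparing the mean slopes on both sides of
  \<open>s\<close>.\<close>

lemma powr_sum_defect_le_linear:
  fixes s k :: real
  assumes "k \<ge> 2" "0 < s" "s \<le> 1"
  shows "(1 + s) powr k - 1 - s powr k \<le> (2 powr k - 2) * s"
proof (cases "s = 1")
  case False
  define g where "g = (\<lambda>s::real. (1 + s) powr k - s powr k)"
  have cont: "continuous_on {0..1} g"
    unfolding g_def using assms(1) by (intro continuous_intros continuous_on_powr') auto
  have powr_der: "((\<lambda>x. (1 + x) powr p - x powr p) has_real_derivative
      p * ((1 + x) powr (p - 1) - x powr (p - 1))) (at x)" if "x > 0" for x p :: real
    using that by (auto intro!: derivative_eq_intros simp: right_diff_distrib powr_diff)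
  have der: "(g has_derivative (\<lambda>h. k * ((1 + x) powr (k - 1) - x powr (k - 1)) * h)) (at x)" if "x > 0" for x
    using powr_der[OF that] unfolding g_def has_field_derivative_def .
  have "continuous_on {0..s} g" "continuous_on {s..1} g"
    using assms by (auto intro: continuous_on_subset[OF cont])
  note cont' = this
  obtain x1 where x1: "0 < x1" "x1 < s" "g s - g 0 = k * ((1 + x1) powr (k - 1) - x1 powr (k - 1)) * (s - 0)"
    by (rule mvt[OF assms(2) cont'(1) der]) auto
  obtain x2 where x2: "s < x2" "x2 < 1" "g 1 - g s = k * ((1 + x2) powr (k - 1) - x2 powr (k - 1)) * (1 - s)"
    by (rule mvt[OF _ cont'(2) der]) (use assms False in auto)
  have mono: "(1 + x1) powr (k - 1) - x1 powr (k - 1) \<le> (1 + x2) powr (k - 1) - x2 powr (k - 1)"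
  proof (rule DERIV_nonneg_imp_nondecreasing[of x1 x2 "\<lambda>x. (1 + x) powr (k - 1) - x powr (k - 1)"])
    show "x1 \<le> x2" using x1 x2 by simp
    fix x assume "x1 \<le> x" "x \<le> x2"
    then have x: "x > 0" using x1 by simp
    have "(k - 1) * ((1 + x) powr (k - 1 - 1) - x powr (k - 1 - 1)) \<ge> 0"
      using x assms(1) by (intro mult_nonneg_nonneg) (auto intro!: powr_mono2)
    then show "\<exists>y. ((\<lambda>x. (1 + x) powr (k - 1) - x powr (k - 1)) has_real_derivative y) (at x) \<and> 0 \<le> y"
      using powr_der[OF x] by (intro exI conjI)
  qed
  have "(g s - g 0) * (1 - s) \<le> (g 1 - g s) * s"
    unfolding x1(3) x2(3) using mult_right_mono[OF mono, of "k * s * (1 - s)"] assms by (simp add: mult_ac)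
  then have "g s - g 0 \<le> (g 1 - g 0) * s"
    by (simp add: algebra_simps)
  then show ?thesis
    using assms(1) by (simp add: g_def)
qed (use assms in simp)

text \<open>The right-hand side is log-concave in \<open>k\<close>, the left-hand side is log-linear, and they agree at
  \<open>k = 1\<close> and \<open>k = 2\<close>.\<close>

lemma sinh_interpolation:
  fixes v k :: real
  assumes "v > 0" "1 \<le> k" "k \<le> 2"
  shows "(2 * cosh v) powr (k - 1) * sinh v \<le> sinh (k * v)"
proof -
  have "concave_on {0<..} (\<lambda>x::real. ln (sinh x))"
  proof (rule f''_le0_imp_concave)
    fix x :: real assume x: "x \<in> {0<..}"
    then have s: "sinh x > 0" by simp
    show "((\<lambda>x. ln (sinh x)) has_real_derivative cosh x / sinh x) (at x)"
      using s by (auto intro!: derivative_eq_intros simp: field_simps)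
    show "((\<lambda>x. cosh x / sinh x) has_real_derivative - (1 / (sinh x)\<^sup>2)) (at x)"
      using s cosh_square_eq[of x]
      by (auto intro!: derivative_eq_intros simp: field_simps power2_eq_square)
  qed auto
  from concave_onD[OF this, of "k - 1" v "2 * v"] assms
  have "(2 - k) * ln (sinh v) + (k - 1) * ln (sinh (2 * v)) \<le> ln (sinh ((2 - k) * v + (k - 1) * (2 * v)))"
    by simp
  also have "(2 - k) * v + (k - 1) * (2 * v) = k * v" by (simp add: algebra_simps)
  also have "sinh (2 * v) = 2 * cosh v * sinh v"
    by (simp add: sinh_double)
  also have "ln (2 * cosh v * sinh v) = ln (2 * cosh v) + ln (sinh v)"
    using assms by (intro ln_mult_pos) auto
  finally have "(k - 1) * ln (2 * cosh v) + ln (sinh v) \<le> ln (sinh (k * v))"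
    by (simp add: algebra_simps)
  moreover have pos: "(2 * cosh v) powr (k - 1) * sinh v > 0" "sinh (k * v) > 0"
    using assms by simp_all
  moreover have "(k - 1) * ln (2 * cosh v) + ln (sinh v) = ln ((2 * cosh v) powr (k - 1) * sinh v)"
    using ln_mult_pos[of "(2 * cosh v) powr (k - 1)" "sinh v"] assms by simp
  ultimately show ?thesis
    using ln_le_cancel_iff[OF pos] by simp
qed

text \<open>With \<open>x = g * exp v\<close> and \<open>y = g * exp (- v)\<close> this is the
  defect of \<open>powr_sum_defect_le_geometric\<close> divided by \<open>g powr k\<close>. It is
  largest at \<open>v = 0\<close>, that is for \<open>x = y\<close>, since
  \<open>sinh_interpolation\<close> fixes the sign of its derivative.\<close>

lemma cosh_powr_defect:
  fixes v k :: real
  assumes "v \<ge> 0" "1 \<le> k" "k \<le> 2"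
  shows "(2 * cosh v) powr k - 2 * cosh (k * v) \<le> 2 powr k - 2"
proof -
  define H where "H = (\<lambda>v. (2 * cosh v) powr k - 2 * cosh (k * v))"
  have "H v \<le> H 0"
  proof (rule DERIV_nonpos_imp_nonincreasing[of 0 v H])
    fix x assume x: "0 \<le> x" "x \<le> v"
    have "(H has_real_derivative 2 * k * ((2 * cosh x) powr (k - 1) * sinh x - sinh (k * x))) (at x)"
      unfolding H_def using cosh_real_pos[of x]
      by (auto intro!: derivative_eq_intros simp: algebra_simps powr_diff)
    moreover have "2 * k * ((2 * cosh x) powr (k - 1) * sinh x - sinh (k * x)) \<le> 0"
      using sinh_interpolation[of x k] x assms by (cases "x = 0") (auto simp: mult_le_0_iff)
    ultimately show "\<exists>y. DERIV H x :> y \<and> y \<le> 0" by blast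
  qed (use assms in auto)
  then show ?thesis by (simp add: H_def)
qed

text \<open>After division by the \<open>k\<close>-th power of the geometric mean only the ratio
  \<open>x / y\<close> matters, and \<open>cosh_powr_defect\<close> applies. This replaces the
  linear bound for exponents at most \<open>2\<close>.\<close>

lemma powr_sum_defect_le_geometric:
  fixes x y k :: real
  assumes "0 < y" "y \<le> x" "1 \<le> k" "k \<le> 2"
  shows "(x + y) powr k - x powr k - y powr k \<le> (2 powr k - 2) * (x * y) powr (k / 2)"
proof -
  define v where "v = ln (x / y) / 2"
  define g where "g = sqrt (x * y)"
  have g: "g > 0" using assms by (simp add: g_def)
  have gp: "g = exp ((ln x + ln y) / 2)"
    using assms by (simp add: g_def ln_mult_pos[symmetric] powr_half_sqrt[symmetric] powr_def)
  have x: "x = g * exp v" and y: "y = g * exp (- v)"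
    using assms by (simp_all add: gp v_def mult_exp_exp ln_div add_divide_distrib[symmetric] diff_divide_distrib[symmetric])
  have "v \<ge> 0" using assms by (simp add: v_def)
  note c = cosh_powr_defect[OF this assms(3,4)]
  have "(x + y) powr k = g powr k * (2 * cosh v) powr k"
    using g by (simp add: x y powr_mult[symmetric] cosh_def algebra_simps)
  moreover have "x powr k = g powr k * exp (k * v)" "y powr k = g powr k * exp (- (k * v))"
    using g by (simp_all add: x y powr_mult) (simp_all add: powr_def)
  moreover have "(x * y) powr (k / 2) = g powr k"
    using assms by (simp add: g_def powr_half_sqrt[symmetric] powr_powr)
  ultimately show ?thesis
    using mult_left_mono[OF c, of "g powr k"] by (simp add: cosh_def algebra_simps)
qed

section \<open>A numerical inequality for powers of \<open>(z + 1) / 2\<close>\<close>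

text \<open>These amount to \<open>8 / 3 \<le> exp 1\<close> and
  \<open>exp (3 / 4) \<le> 5 / 2\<close>. They are the two coefficient comparisons in the estimate
  \<open>zlnz\<close> of the next lemma.\<close>

lemma ln_numeric_bounds: "ln (8 / 3 :: real) \<le> 1" "3 / 4 \<le> ln (5 / 2 :: real)"
proof -
  \<comment> \<open>The left-hand side is 41/32, whose fourth power is just above 8/3.\<close>
  have "1 + 1 / 4 + (1 / 4)\<^sup>2 / 2 \<le> exp (1 / 4 :: real)"
    by (rule exp_lower_Taylor_quadratic) simp
  then have "(41 / 32 :: real) ^ 4 \<le> exp (1 / 4) ^ 4"
    by (intro power_mono) (simp_all add: power2_eq_square)
  also have "\<dots> = exp (1 :: real)"
    by (simp add: exp_of_nat_mult[symmetric])
  finally have "8 / 3 \<le> exp (1 :: real)"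
    by (simp add: eval_nat_numeral)
  then have "ln (8 / 3) \<le> ln (exp (1 :: real))"
    by (subst ln_le_cancel_iff) simp_all
  then show "ln (8 / 3 :: real) \<le> 1"
    by simp
  have "(3 / 4 :: real) ^ 3 \<le> exp (- 1 / 4) ^ 3"
    using exp_ge_add_one_self[of "- 1 / 4 :: real"] by (intro power_mono) simp_all
  also have "\<dots> = exp (- 3 / 4 :: real)"
    by (simp add: exp_of_nat_mult[symmetric])
  finally have "2 / 5 \<le> exp (- (3 / 4) :: real)"
    by (simp add: eval_nat_numeral)
  then have "exp (3 / 4 :: real) \<le> 5 / 2"
    by (simp add: exp_minus field_simps)
  then show "3 / 4 \<le> ln (5 / 2 :: real)"
    by (subst ln_ge_iff) simp_all
qed

text \<open>The factor \<open>4\<close> is \<open>2 * c\<close> and \<open>5\<close> is a lower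
  bound for \<open>c + young_const c l\<close> at \<open>c = 2\<close>, a value chosen in
  \<open>admissible_exists\<close>. AM-GM turns the sum on the right into a product; the logarithms
  then compared are affine in \<open>b\<close>, so their values at \<open>b = 1\<close> and their
  slopes suffice.\<close>

lemma midpoint_powr_bound_ge_1:
  fixes z b :: real
  assumes z: "z \<ge> 1" and b: "b \<ge> 1"
  shows "4 * ((z + 1) / 2) powr b \<le> 5 + z powr (b + 1 / 2)"
proof -
  \<comment> \<open>The comparison of slopes in \<open>b\<close>, from concavity of
    \<open>ln\<close> at the points \<open>1 / z\<close> and \<open>1\<close>.\<close>
  have ent: "(z + 1) * ln ((z + 1) / 2) \<le> z * ln z"
  proof -
    have "(1 - 1 / (z + 1)) * ln (1 / z) + 1 / (z + 1) * ln 1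
      \<le> ln ((1 - 1 / (z + 1)) * (1 / z) + 1 / (z + 1) * 1)"
      using concave_onD[OF ln_concave, of "1 / (z + 1)" "1 / z" 1] z by simp
    also have "(1 - 1 / (z + 1)) * (1 / z) + 1 / (z + 1) * 1 = inverse ((z + 1) / 2)"
      using z by (simp add: field_simps)
    finally have "ln ((z + 1) / 2) \<le> (1 - 1 / (z + 1)) * ln z"
      using z by (simp add: ln_div ln_inverse[of "(z+1)/2"])
    then have "(z + 1) * ln ((z + 1) / 2) \<le> (z + 1) * ((1 - 1 / (z + 1)) * ln z)"
      using z by (intro mult_left_mono) auto
    also have "(z + 1) * (1 - 1 / (z + 1)) = z"
      using z by (simp add: right_diff_distrib)
    then have "(z + 1) * ((1 - 1 / (z + 1)) * ln z) = z * ln z"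
      by (metis mult.assoc)
    finally show ?thesis .
  qed
  \<comment> \<open>The comparison at \<open>b = 1\<close>; its proof bounds \<open>z * ln z\<close>
    below by the tangent at \<open>z = 3 / 2\<close>.\<close>
  have zlnz: "(z + 1) * ln 2 \<le> ln 5 + z * ln z / 2"
  proof -
    have "ln (3 / (2 * z)) \<le> 3 / (2 * z) - 1"
      using z by (intro ln_le_minus_one) simp
    then have "z * (1 + ln 3 - ln 2 - ln z) \<le> z * (3 / (2 * z))"
      using z by (intro mult_left_mono) (simp_all add: ln_div ln_mult_pos)
    then have 1: "z * (1 + ln 3 - ln 2) - 3 / 2 \<le> z * ln z"
      using z by (simp add: algebra_simps)
    have "ln 8 = 3 * ln (2 :: real)"
      using ln_realpow[of 2 3] by simp
    then have "2 * ln 2 \<le> 1 + ln 3 - ln (2::real)" "3 / 4 \<le> ln 5 - ln (2::real)"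
      using ln_numeric_bounds by (simp_all add: ln_div)
    with mult_left_mono[OF this(1), of z] z 1 show ?thesis
      by (simp add: algebra_simps)
  qed
  \<comment> \<open>weighted AM--GM with weights \<open>1 / (z + 1)\<close> and \<open>z / (z + 1)\<close>, for which the resulting exponent of
    \<open>z / ((z + 1) / 2)\<close> dominates by \<open>ent\<close>\<close>
  define R where "R = (5 * (z + 1)) powr (1 / (z + 1)) * ((z + 1) / z * z powr (b + 1 / 2)) powr (z / (z + 1))"
  have "R \<le> 1 / (z + 1) * (5 * (z + 1)) + z / (z + 1) * ((z + 1) / z * z powr (b + 1 / 2))"
    unfolding R_def using z by (intro Youngs_inequality_0) (auto simp: add_divide_distrib[symmetric])
  also have "z / (z + 1) * ((z + 1) / z * z powr (b + 1 / 2)) = z powr (b + 1 / 2)"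
    using z by simp
  also have "1 / (z + 1) * (5 * (z + 1)) = 5"
    using z by (simp add: field_simps)
  finally have R: "R \<le> 5 + z powr (b + 1 / 2)" .
  have "ln (4 * ((z + 1) / 2) powr b) \<le> ln R"
  proof -
    have "(b - 1) * ((z + 1) * ln ((z + 1) / 2)) \<le> (b - 1) * (z * ln z)"
      using ent b by (intro mult_left_mono) simp_all
    then have "(z + 1) * (2 * ln 2 + b * ln ((z + 1) / 2)) \<le>
        (ln 5 + ln (z + 1)) + z * (ln (z + 1) - ln z + (b + 1 / 2) * ln z)"
      using zlnz z by (simp add: ln_div algebra_simps)
    then have "2 * ln 2 + b * ln ((z + 1) / 2) \<le>
        ((ln 5 + ln (z + 1)) + z * (ln (z + 1) - ln z + (b + 1 / 2) * ln z)) / (z + 1)"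
      using z by (simp add: pos_le_divide_eq mult.commute)
    also have "\<dots> = ln R"
    proof -
      have 1: "ln (5 * (z + 1)) = ln 5 + ln (z + 1)"
        using z by (intro ln_mult_pos) auto
      have 2: "ln ((z + 1) / z * z powr (b + 1 / 2)) = ln (z + 1) - ln z + (b + 1 / 2) * ln z"
        using z by (subst ln_mult_pos) (auto simp: ln_div)
      have pos: "(5 * (z + 1)) powr (1 / (z + 1)) > 0"
        "((z + 1) / z * z powr (b + 1 / 2)) powr (z / (z + 1)) > 0"
        using z by auto
      show ?thesis
        unfolding R_def ln_mult_pos[OF pos] ln_powr 1 2 by (simp add: add_divide_distrib)
    qed
    also have "2 * ln 2 + b * ln ((z + 1) / 2) = ln (4 * ((z + 1) / 2) powr b)"
      using z ln_realpow[of 2 2] by (simp add: ln_mult_pos)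
    finally show ?thesis .
  qed
  moreover have "4 * ((z + 1) / 2) powr b > 0" "R > 0"
    using z by (simp_all add: R_def)
  ultimately show ?thesis
    using R by simp
qed

text \<open>For \<open>r \<ge> 4\<close>, \<open>m \<le> z\<close> is enough. Otherwise both sides
  are squared, using \<open>20 * p \<le> (5 + p)\<^sup>2\<close>. Since
  \<open>m\<^sup>2 / z \<ge> 1\<close> and \<open>b \<le> 1\<close>, the power \<open>b\<close> of
  this quotient is at most the quotient itself, which leaves the polynomial inequality
  \<open>poly\<close>.\<close>

lemma midpoint_powr_bound_le_1:
  fixes z b :: real
  assumes z: "z \<ge> 1" and b: "0 \<le> b" "b \<le> 1"
  shows "4 * ((z + 1) / 2) powr b \<le> 5 + z powr (b + 1 / 2)"
proof -
  define m where "m = (z + 1) / 2"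
  define r where "r = sqrt z"
  have m: "m \<ge> 1" "m \<le> z" and r: "r \<ge> 1" "z = r\<^sup>2"
    using z by (simp_all add: m_def r_def)
  have split: "z powr (b + 1 / 2) = z powr b * r"
    using z by (simp add: powr_add powr_half_sqrt r_def)
  have mz: "m powr b \<le> z powr b"
    using m b by (intro powr_mono2) auto
  show ?thesis
  proof (cases "r \<ge> 4")
    case True
    then have "z powr b * 4 \<le> z powr b * r"
      by (intro mult_left_mono) auto
    with mz show ?thesis
      unfolding split m_def[symmetric] by linarith
  next
    case False
    have "(r - 1) * (r - 4) \<le> 0"
      using False r by (intro mult_nonneg_nonpos) auto
    then have "r\<^sup>2 * ((r - 1) * (r - 4)) \<le> 0"
      by (rule mult_nonneg_nonpos[rotated]) simp
    then have poly: "(r\<^sup>2 + 1)\<^sup>2 \<le> 5 * r\<^sup>2 * r"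
      using r(1) one_le_power[OF r(1), of 2] by (simp add: power2_eq_square algebra_simps)
    have "m\<^sup>2 / z \<ge> 1"
      using z sum_squares_bound[of z 1] by (simp add: m_def field_simps power2_eq_square)
    then have "(m\<^sup>2 / z) powr b \<le> m\<^sup>2 / z"
      using b powr_mono[of b 1 "m\<^sup>2 / z"] by simp
    then have "16 * (m\<^sup>2 / z) powr b * z powr b \<le> 16 * (m\<^sup>2 / z) * z powr b"
      by (intro mult_right_mono) auto
    also have "\<dots> \<le> 20 * r * z powr b"
    proof (rule mult_right_mono)
      have "16 * (m\<^sup>2 / z) = 4 * ((r\<^sup>2 + 1)\<^sup>2 / r\<^sup>2)"
        by (simp add: m_def r(2) power_divide)
      also have "\<dots> \<le> 4 * (5 * r\<^sup>2 * r / r\<^sup>2)"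
        using poly by (intro mult_left_mono divide_right_mono) auto
      finally show "16 * (m\<^sup>2 / z) \<le> 20 * r"
        using r(1) by simp
    qed simp
    finally have "16 * ((m\<^sup>2 / z) powr b * z powr b) \<le> 20 * (z powr b * r)"
      by (simp add: mult.assoc mult.commute)
    also have "(m\<^sup>2 / z) powr b * z powr b = (m powr b)\<^sup>2"
      unfolding powr_mult[symmetric] using z by (simp add: power2_eq_square powr_mult)
    finally have "(4 * m powr b)\<^sup>2 \<le> 20 * (z powr b * r)"
      by (simp add: power_mult_distrib)
    also have "\<dots> \<le> (5 + z powr b * r)\<^sup>2"
      using zero_le_power2[of "5 - z powr b * r"] by (simp add: power2_sum power2_diff mult.commute)
    finally have "4 * m powr b \<le> 5 + z powr b * r"
      by (rule power2_le_imp_le) (use r(1) in simp)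
    then show ?thesis
      unfolding split m_def[symmetric] .
  qed
qed

lemma midpoint_powr_bound:
  fixes z b :: real
  assumes "z \<ge> 1" "b \<ge> 0"
  shows "4 * ((z + 1) / 2) powr b \<le> 5 + z powr (b + 1 / 2)"
  using midpoint_powr_bound_ge_1 midpoint_powr_bound_le_1 assms by (meson linear)

section \<open>The constant in the moment bound\<close>

text \<open>
  This is \<open>2 C_const\<close> up to scaling, see \<open>C_const_young_const\<close>. It is the supremum of
  \<open>2 c v\<^sup>l - v\<close> over \<open>v > 0\<close> if \<open>0 \<le> l < 1\<close>, and the minimum of \<open>2 c v\<^sup>l + v\<close> if \<open>l < 0\<close>.
\<close>

definition young_const :: "real \<Rightarrow> real \<Rightarrow> real" where
  "young_const c l = 2 * (1 - l) * c powr (1 / (1 - l)) * (if l = 0 then 1 else (2 * l) powr (l / (1 - l)))"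

text \<open>Weighted AM-GM with weights \<open>l\<close> and \<open>1 - l\<close> for
  \<open>v / l\<close> and \<open>young_const c l / (1 - l)\<close>: the weighted product is exactly
  \<open>2 * c * v powr l\<close>. For \<open>l = 0\<close> the constant is
  \<open>2 * c\<close>.\<close>

lemma young_const_nonneg:
  assumes "0 \<le> l" "l < 1" "c > 0" "v > 0"
  shows "2 * c * v powr l \<le> v + young_const c l"
proof (cases "l = 0")
  case False
  define Q where "Q = young_const c l"
  have Q: "Q / (1 - l) = 2 * c powr (1 / (1 - l)) * (2 * l) powr (l / (1 - l))"
    using False assms by (simp add: Q_def young_const_def del: right_diff_distrib_numeral)
  have "(v / l) powr l * (Q / (1 - l)) powr (1 - l) \<le> l * (v / l) + (1 - l) * (Q / (1 - l))"
    using False assms by (intro Youngs_inequality_0) (simp_all add: Q)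
  also have "\<dots> = v + Q"
    using False assms by simp
  also have "(v / l) powr l * (Q / (1 - l)) powr (1 - l) = 2 powr (1 - l) * 2 powr l * c * v powr l"
    using False assms by (simp add: Q powr_mult powr_powr powr_divide)
  also have "\<dots> = 2 * c * v powr l"
    by (simp add: powr_add[symmetric])
  finally show ?thesis by (simp add: Q_def)
qed (use assms in \<open>simp add: young_const_def\<close>)

text \<open>With \<open>n = - l\<close>, AM-GM reduces the claim to
  \<open>8 * n * n \<le> 1 + 8 * n\<close>, true for \<open>n \<le> 1\<close>. The value
  \<open>3\<close> is the \<open>c + 1\<close> of \<open>admissible\<close> at
  \<open>c = 2\<close>.\<close>

lemma young_const_neg_ge_3:
  assumes "- 1 \<le> l" "l < 0"
  shows "3 \<le> young_const 2 l"
proof -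
  define n where "n = - l"
  have n: "0 < n" "n \<le> 1" using assms by (simp_all add: n_def)
  have e: "1 / (1 + n) = 1 - n / (1 + n)" "l / (1 - l) = - (n / (1 + n))"
    using n by (simp_all add: n_def field_simps)
  have "n * n \<le> n"
    using n by simp
  then have nn: "n * (n * 8) \<le> 1 + n * 8"
    using n by linarith
  have "(4 * n) powr (n / (1 + n)) * 1 powr (1 / (1 + n)) \<le> n / (1 + n) * (4 * n) + 1 / (1 + n) * 1"
    using n by (intro Youngs_inequality_0) (auto simp: add_divide_distrib[symmetric])
  also have "3 * \<dots> \<le> 4 * (1 + n)"
    using n nn by (simp add: field_simps)
  finally have *: "3 * (4 * n) powr (n / (1 + n)) \<le> 4 * (1 + n)"
    by simp
  \<comment> \<open>The base \<open>2 * l\<close> is negative here, so \<open>powr\<close> sees its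
    absolute value \<open>2 * n\<close>.\<close>
  have "young_const 2 l = 2 * (1 + n) * 2 powr (1 / (1 + n)) * (2 * n) powr (- (n / (1 + n)))"
    using assms uminus_powr_eq[of "2 * n"] by (simp add: young_const_def e(2)) (simp add: n_def)
  also have "\<dots> = 4 * (1 + n) / (4 * n) powr (n / (1 + n))"
  proof -
    have "(4 * n) powr (n / (1 + n)) = 2 powr (n / (1 + n)) * (2 * n) powr (n / (1 + n))"
      unfolding powr_mult[symmetric] by simp
    then show ?thesis
      unfolding e(1) powr_minus_divide powr_diff by simp
  qed
  finally show ?thesis
    using * n by (simp add: pos_le_divide_eq del: distrib_left_numeral)
qed

text \<open>For this \<open>c\<close> the minimum of \<open>2 * c * v powr l + v\<close> is attained
  at \<open>v = 1\<close> and equals \<open>2 * c + 1\<close>.\<close>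

lemma young_const_neg_eq:
  assumes "l < 0"
  shows "young_const (- 1 / (2 * l)) l = 1 - 1 / l"
proof -
  define n where "n = - l"
  have n: "0 < n" using assms by (simp add: n_def)
  have e: "l / (1 - l) = 1 / (1 + n) - 1"
    using n by (simp add: n_def field_simps)
  have "young_const (- 1 / (2 * l)) l = 2 * (1 + n) * (1 / (2 * n)) powr (1 / (1 + n)) * (2 * n) powr (1 / (1 + n) - 1)"
    using assms uminus_powr_eq[of "2 * n"] by (simp add: young_const_def e) (simp add: n_def)
  also have "\<dots> = (1 + n) / n"
    using n by (simp add: powr_divide powr_diff del: distrib_left_numeral)
  finally show ?thesis
    using n by (simp add: n_def field_simps)
qed

text \<open>
  The conditions on the free parameter \<open>c\<close>, which fixes the threshold \<open>a\<close> of the test function, under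
  which merging is dominated by the loss. The second growth condition is only needed for \<open>k < 2\<close>.
\<close>

definition admissible :: "real \<Rightarrow> real \<Rightarrow> real \<Rightarrow> bool" where
  "admissible c l e \<longleftrightarrow> c > 0 \<and> c + 1 \<le> young_const c l \<and>
     (\<forall>x\<ge>1. 2 * c * x powr (e * l) \<le> c + young_const c l + x powr e) \<and>
     (\<forall>x\<ge>1. \<forall>b\<ge>0. \<forall>\<nu>. 0 \<le> \<nu> \<and> \<nu> \<le> 1 / 2 \<and> b + 1 / 2 - \<nu> \<le> e \<longrightarrow>
       2 * c * (x powr - \<nu> * ((x + 1) / 2) powr b) \<le> c + young_const c l + x powr e)"

text \<open>For \<open>l \<ge> - 1\<close> the value \<open>c = 2\<close> works because
  \<open>young_const 2 l \<ge> 3\<close>. That bound fails for very negative \<open>l\<close>; there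
  \<open>c = - 1 / (2 * l)\<close> gives \<open>young_const c l = 1 + 2 * c\<close> with
  \<open>2 * c \<le> 1\<close>, and crude estimates suffice.\<close>

lemma admissible_exists:
  assumes "l < 1" "e > 0"
  shows "\<exists>c. admissible c l e"
proof (cases "l \<ge> - 1")
  case True
  \<comment> \<open>For \<open>l \<ge> 0\<close> this is the Young bound at
    \<open>v = 1\<close>.\<close>
  have ge3: "3 \<le> young_const 2 l"
    using young_const_neg_ge_3[of l] young_const_nonneg[of l 2 1] True assms by (cases "l \<ge> 0") auto
  have "2 * 2 * x powr (e * l) \<le> 2 + young_const 2 l + x powr e" if x: "x \<ge> 1" for x
  proof (cases "l \<ge> 0")
    case True
    then show ?thesis
      using young_const_nonneg[of l 2 "x powr e"] assms x by (simp add: powr_powr)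
  next
    case False
    then have "x powr (e * l) \<le> 1" "x powr e \<ge> 1"
      using x assms powr_mono[of "e * l" 0 x] by (auto simp: ge_one_powr_ge_zero mult_le_0_iff)
    with ge3 show ?thesis by linarith
  qed
  moreover have "2 * 2 * (x powr - \<nu> * ((x + 1) / 2) powr b) \<le> 2 + young_const 2 l + x powr e"
    if *: "x \<ge> 1" "b \<ge> 0" "0 \<le> \<nu>" "b + 1 / 2 - \<nu> \<le> e" for x b \<nu> :: real
  proof -
    have "4 * (x powr - \<nu> * ((x + 1) / 2) powr b) = x powr - \<nu> * (4 * ((x + 1) / 2) powr b)"
      by simp
    also have "\<dots> \<le> x powr - \<nu> * (5 + x powr (b + 1 / 2))"
      using midpoint_powr_bound[of x b] * by (intro mult_left_mono) auto
    also have "\<dots> = 5 * x powr - \<nu> + x powr (b + 1 / 2 - \<nu>)"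
      using * by (simp add: algebra_simps powr_add[symmetric])
    also have "\<dots> \<le> 5 * 1 + x powr e"
      using * powr_mono[of "- \<nu>" 0 x] by (intro add_mono mult_left_mono powr_mono) auto
    finally show ?thesis using ge3 by simp
  qed
  ultimately have "admissible 2 l e"
    unfolding admissible_def using ge3 by auto
  then show ?thesis ..
next
  case False
  define c where "c = - 1 / (2 * l)"
  have c: "c > 0" "2 * c \<le> 1" "young_const c l = 1 + 2 * c"
    using False young_const_neg_eq[of l] by (auto simp: c_def field_simps)
  have "2 * c * x powr (e * l) \<le> c + young_const c l + x powr e" if x: "x \<ge> 1" for x
  proof -
    have "x powr (e * l) \<le> 1"
      using x assms False powr_mono[of "e * l" 0 x] by (auto simp: mult_le_0_iff)
    from mult_left_mono[OF this, of "2 * c"] show ?thesis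
      using c powr_ge_zero[of x e] by linarith
  qed
  moreover have "2 * c * (x powr - \<nu> * ((x + 1) / 2) powr b) \<le> c + young_const c l + x powr e"
    if *: "x \<ge> 1" "b \<ge> 0" "0 \<le> \<nu>" "\<nu> \<le> 1 / 2" "b + 1 / 2 - \<nu> \<le> e" for x b \<nu> :: real
  proof -
    \<comment> \<open>The bound \<open>\<nu> \<le> 1 / 2\<close> turns the exponent condition into
      \<open>b \<le> e\<close>.\<close>
    have "x powr - \<nu> * ((x + 1) / 2) powr b \<le> 1 * x powr e"
      using * powr_mono[of "- \<nu>" 0 x] powr_mono2[of b "(x + 1) / 2" x] powr_mono[of b e x]
      by (intro mult_mono) auto
    also have "2 * c * \<dots> \<le> 1 * (1 * x powr e)"
      using c by (intro mult_right_mono) auto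
    finally show ?thesis using c by (simp add: mult_left_mono)
  qed
  ultimately have "admissible c l e"
    unfolding admissible_def using c by auto
  then show ?thesis ..
qed

text \<open>With \<open>D = 2 * a + b + k - 2\<close>, the identity \<open>e - D = q\<close> matches
  the exponents of \<open>young_const\<close> at \<open>l = D / e\<close> with those of
  \<open>C_const\<close>. The powers of \<open>A\<close> cancel and leave \<open>c\<close> in place
  of the bracket.\<close>

lemma C_const_young_const:
  fixes a b \<delta> k c :: real
  defines "A \<equiv> 2 powr (b + 1) * (2 powr k - 2)" and "e \<equiv> \<delta> + k - 1" and "q \<equiv> \<delta> - 2 * a - b + 1"
  assumes "k > 1" "q > 0" "e > 0" "c > 0"
  shows "2 * C_const a b \<delta> k * (c / A) powr (e / q) = young_const c ((2 * a + b + k - 2) / e)"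
proof -
  define D where "D = 2 * a + b + k - 2"
  have A: "A powr (e / q) > 0"
    using assms(4) powr_less_mono[of 1 k 2] by (simp add: A_def)
  have qe: "1 - D / e = q / e"
  proof -
    have "e - D = q" by (simp add: D_def e_def q_def)
    then show ?thesis using \<open>e > 0\<close> by (simp add: diff_divide_eq_iff)
  qed
  have "C_const a b \<delta> k = q / e * A powr (e / q) * (if D = 0 then 1 else (2 * D / e) powr (D / q))"
    unfolding C_const_def D_def A_def e_def q_def by (rule refl)
  then have "2 * C_const a b \<delta> k * (c / A) powr (e / q) =
      2 * (q / e) * (if D = 0 then 1 else (2 * D / e) powr (D / q)) * (A powr (e / q) * (c / A) powr (e / q))"
    by (simp only: mult_ac)
  also have "A powr (e / q) * (c / A) powr (e / q) = c powr (e / q)"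
    using A unfolding powr_divide by simp
  also have "2 * (q / e) * (if D = 0 then 1 else (2 * D / e) powr (D / q)) * c powr (e / q) = young_const c (D / e)"
    using assms(5,6) by (simp add: young_const_def qe)
  finally show ?thesis by (simp add: D_def)
qed

section \<open>The pointwise bound on merging\<close>

definition test_fun :: "real \<Rightarrow> real \<Rightarrow> real \<Rightarrow> real" where
  "test_fun k a x = x * max x a powr (k - 1)"

lemma test_fun_ge: "a \<le> x \<Longrightarrow> 0 \<le> x \<Longrightarrow> test_fun k a x = x powr k"
  by (simp add: test_fun_def powr_mult_base max_absorb1)

lemma test_fun_le: "x \<le> a \<Longrightarrow> test_fun k a x = x * a powr (k - 1)"
  by (simp add: test_fun_def max_absorb2)

lemma test_fun_nonneg: "x \<ge> 0 \<Longrightarrow> test_fun k a x \<ge> 0"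
  by (simp add: test_fun_def)

lemma test_fun_mono:
  "0 \<le> x \<Longrightarrow> x \<le> y \<Longrightarrow> k > 1 \<Longrightarrow> a > 0 \<Longrightarrow> test_fun k a x \<le> test_fun k a y"
  unfolding test_fun_def by (intro mult_mono powr_mono2) auto

lemma test_fun_superadditive:
  "0 \<le> x \<Longrightarrow> 0 \<le> y \<Longrightarrow> k > 1 \<Longrightarrow> a > 0 \<Longrightarrow> test_fun k a x + test_fun k a y \<le> test_fun k a (x + y)"
  unfolding test_fun_def by (rule superadditive_mult_mono) (auto intro!: powr_mono2)

lemma powr_le_test_fun:
  "0 \<le> x \<Longrightarrow> k > 1 \<Longrightarrow> a > 0 \<Longrightarrow> x powr k \<le> test_fun k a x"
  using mult_left_mono[OF powr_mono2[of "k - 1" x "max x a"], of x]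
  by (simp add: test_fun_def powr_mult_base)

lemma kern_nonneg [simp]: "kern a b x y \<ge> 0"
  by (simp add: kern_def)

lemma kern_commute: "kern a b x y = kern a b y x"
  by (simp add: kern_def add.commute)

text \<open>In \<open>ln y\<close>, the logarithm of the factor is convex, so it suffices to check \<open>y = 1\<close> and \<open>y = x\<close>.\<close>

lemma geometric_kernel_factor_bound:
  fixes x y b \<nu> G :: real
  assumes "1 \<le> y" "y \<le> x" "b \<ge> 0"
    and "x powr - \<nu> * ((x + 1) / 2) powr b \<le> G" "x powr (b - 2 * \<nu>) \<le> G"
  shows "(x * y) powr - \<nu> * ((x + y) / 2) powr b \<le> G"
proof (cases "x = 1")
  case True
  then show ?thesis using assms by simp
next
  case False
  then have x: "x > 1" using assms by simp
  define \<theta> where "\<theta> = ln y / ln x"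
  have th: "0 \<le> \<theta>" "\<theta> \<le> 1" "y = x powr \<theta>"
    using assms x by (simp_all add: \<theta>_def powr_def)
  have ar: "x + y \<le> (x + 1) powr (1 - \<theta>) * (2 * x) powr \<theta>"
  proof -
    have "(x / (x + 1)) powr (1 - \<theta>) * (1 / 2) powr \<theta> + (1 / (x + 1)) powr (1 - \<theta>) * (1 / 2) powr \<theta>
        \<le> ((1 - \<theta>) * (x / (x + 1)) + \<theta> * (1 / 2)) + ((1 - \<theta>) * (1 / (x + 1)) + \<theta> * (1 / 2))"
      using th x by (intro add_mono Youngs_inequality_0) auto
    also have "\<dots> = (1 - \<theta>) * ((x + 1) / (x + 1)) + \<theta>"
      unfolding add_divide_distrib by (simp add: algebra_simps)
    also have "\<dots> = 1" using x by simp
    finally have "(x powr (1 - \<theta>) + 1) / ((x + 1) powr (1 - \<theta>) * 2 powr \<theta>) \<le> 1"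
      by (simp add: powr_divide add_divide_distrib)
    then have "x powr (1 - \<theta>) + 1 \<le> (x + 1) powr (1 - \<theta>) * 2 powr \<theta>"
      using x by (simp add: pos_divide_le_eq)
    then have "(x powr (1 - \<theta>) + 1) * x powr \<theta> \<le> (x + 1) powr (1 - \<theta>) * 2 powr \<theta> * x powr \<theta>"
      by (rule mult_right_mono) simp
    then show ?thesis
      using x th by (simp add: distrib_right powr_add[symmetric] powr_mult mult.assoc)
  qed
  define P where "P = x powr - \<nu> * ((x + 1) / 2) powr b"
  define Q where "Q = x powr (b - 2 * \<nu>)"
  have "(x + y) / 2 \<le> ((x + 1) / 2) powr (1 - \<theta>) * x powr \<theta>"
    using ar by (simp add: powr_divide powr_mult powr_diff field_simps)
  then have "((x + y) / 2) powr b \<le> (((x + 1) / 2) powr (1 - \<theta>) * x powr \<theta>) powr b"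
    using assms by (intro powr_mono2) auto
  then have "(x * y) powr - \<nu> * ((x + y) / 2) powr b
      \<le> (x * y) powr - \<nu> * (((x + 1) / 2) powr (1 - \<theta>) * x powr \<theta>) powr b"
    by (intro mult_left_mono) auto
  also have "\<dots> = x powr (- \<nu> - \<theta> * \<nu> + \<theta> * b) * ((x + 1) / 2) powr (b * (1 - \<theta>))"
  proof -
    have "x powr (- \<nu> - \<theta> * \<nu> + \<theta> * b) = x powr - \<nu> * x powr (\<theta> * - \<nu>) * x powr (\<theta> * b)"
      unfolding powr_add[symmetric] by simp
    then show ?thesis
      unfolding th(3) powr_mult powr_powr by (simp add: mult_ac)
  qed
  also have "\<dots> = P powr (1 - \<theta>) * Q powr \<theta>"
    by (simp add: P_def Q_def powr_mult powr_powr powr_add[symmetric] algebra_simps)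
  also have "\<dots> \<le> (1 - \<theta>) * P + \<theta> * Q"
    using th x by (intro Youngs_inequality_0) (auto simp: P_def Q_def)
  also have "\<dots> \<le> (1 - \<theta>) * G + \<theta> * G"
    using assms th by (intro add_mono mult_left_mono) (auto simp: P_def Q_def)
  finally show ?thesis by (simp add: algebra_simps)
qed

locale merge_bound =
  fixes al be \<delta> k c :: real
  assumes al: "al > 0" and be: "be > 0" and k: "k > 1" and \<delta>: "\<delta> > al + be"
    and adm: "admissible c ((2 * al + be + k - 2) / (\<delta> + k - 1)) (\<delta> + k - 1)"
begin

abbreviation "e \<equiv> \<delta> + k - 1"

definition "b0 = young_const c ((2 * al + be + k - 2) / e)"

text \<open>For \<open>z \<ge> 1\<close> the quantity \<open>c / 2 * \<tau> z\<close> is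
  \<open>b0 / 2\<close> plus half of \<open>z powr e\<close>, the scaled loss. For
  \<open>z < 1\<close> the loss may be tiny, and the \<open>- 1\<close> supplies the damping
  instead.\<close>

definition \<tau> :: "real \<Rightarrow> real" where
  "\<tau> z = (b0 + (if z \<ge> 1 then z powr e else - 1)) / c"

lemma e_pos: "e > 0" and c_pos: "c > 0" and b0_ge: "c + 1 \<le> b0"
  using al be k \<delta> adm by (auto simp: admissible_def b0_def)

lemma two_powr_k: "2 powr k - 2 > 0"
  using powr_less_mono[of 1 k 2] k by simp

lemma \<tau>_ge_1: "\<tau> z \<ge> 1"
proof -
  have "c \<le> b0 + z powr e"
    using b0_ge powr_ge_zero[of z e] by linarith
  then have "c \<le> b0 + (if z \<ge> 1 then z powr e else - 1)"
    using b0_ge by simp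
  then show ?thesis
    using c_pos by (simp add: \<tau>_def)
qed

lemma growth_1:
  assumes "x \<ge> 1"
  shows "x powr (2 * al + be + k - 2) \<le> (\<tau> x + 1) / 2"
proof -
  have "2 * c * x powr (e * ((2 * al + be + k - 2) / e)) \<le> c + b0 + x powr e"
    using adm assms unfolding admissible_def b0_def by blast
  also have "e * ((2 * al + be + k - 2) / e) = 2 * al + be + k - 2"
    using e_pos by simp
  finally show ?thesis
    using assms c_pos by (simp add: \<tau>_def field_simps)
qed

text \<open>This is the second growth condition of \<open>admissible\<close> at
  \<open>b = be\<close>: \<open>al > 0\<close> and \<open>k > 1\<close> keep
  \<open>1 - al - k / 2\<close> below \<open>1 / 2\<close>, and \<open>\<delta> > al + be\<close>
  gives the condition on the exponents.\<close>

lemma growth_2: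
  assumes "x \<ge> 1" "1 - al - k / 2 \<ge> 0"
  shows "x powr - (1 - al - k / 2) * ((x + 1) / 2) powr be \<le> (\<tau> x + 1) / 2"
proof -
  have "2 * c * (x powr - (1 - al - k / 2) * ((x + 1) / 2) powr be) \<le> c + b0 + x powr e"
    using conjunct2[OF conjunct2[OF conjunct2[OF adm[unfolded admissible_def]]],
        rule_format, of x be "1 - al - k / 2"] assms al be k \<delta>
    unfolding b0_def by simp
  then show ?thesis
    using assms c_pos by (simp add: \<tau>_def field_simps)
qed

abbreviation "\<phi> \<equiv> test_fun k 1"

text \<open>For \<open>k \<le> 2\<close> the geometric bound leaves the factor
  \<open>(x * y) powr - \<nu> * ((x + y) / 2) powr be\<close>. If \<open>\<nu> \<ge> 0\<close> its
  values at \<open>y = 1\<close> (\<open>growth_2\<close>) and \<open>y = x\<close>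
  (\<open>growth_1\<close>) control it; if \<open>\<nu> < 0\<close> it increases with
  \<open>y\<close>. For \<open>k > 2\<close> the linear bound is used and the kernel is bounded by
  its value at \<open>y = x\<close>.\<close>

lemma defect_ge_1:
  assumes "1 \<le> y" "y \<le> x"
  shows "kern al be x y * (\<phi> (x + y) - \<phi> x - \<phi> y) \<le> 2 powr be * (2 powr k - 2) * (x * y) * ((\<tau> x + 1) / 2)"
proof -
  have \<phi>: "\<phi> (x + y) - \<phi> x - \<phi> y = (x + y) powr k - x powr k - y powr k"
    using assms by (simp add: test_fun_ge)
  have kern: "kern al be x y = 2 powr be * ((x * y) powr al * ((x + y) / 2) powr be)"
    by (simp add: kern_def powr_mult powr_divide)
  show ?thesis
  proof (cases "k \<le> 2")
    case True
    define \<nu> where "\<nu> = 1 - al - k / 2"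
    have "(x * y) powr - \<nu> * ((x + y) / 2) powr be \<le> (\<tau> x + 1) / 2"
    proof (cases "\<nu> \<ge> 0")
      case True
      show ?thesis
        using growth_1[of x] growth_2[of x] assms be True
        by (intro geometric_kernel_factor_bound) (auto simp: \<nu>_def algebra_simps)
    next
      case False
      have "(x * y) powr - \<nu> * ((x + y) / 2) powr be \<le> (x * x) powr - \<nu> * x powr be"
        using assms be False by (intro mult_mono powr_mono2 mult_left_mono) auto
      also have "\<dots> = x powr (2 * al + be + k - 2)"
        by (simp add: powr_mult powr_add[symmetric] \<nu>_def algebra_simps)
      finally show ?thesis using growth_1[of x] assms by simp
    qed
    then have *: "2 powr be * (2 powr k - 2) * (x * y) * ((x * y) powr - \<nu> * ((x + y) / 2) powr be)
        \<le> 2 powr be * (2 powr k - 2) * (x * y) * ((\<tau> x + 1) / 2)"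
      using two_powr_k assms by (intro mult_left_mono) auto
    have "kern al be x y * (\<phi> (x + y) - \<phi> x - \<phi> y) \<le> kern al be x y * ((2 powr k - 2) * (x * y) powr (k / 2))"
      unfolding \<phi> using assms k True by (intro mult_left_mono powr_sum_defect_le_geometric) auto
    also have "\<dots> = 2 powr be * (2 powr k - 2) * ((x * y) powr (al + k / 2)) * ((x + y) / 2) powr be"
      by (simp add: kern powr_add mult_ac)
    also have "(x * y) powr (al + k / 2) = (x * y) * (x * y) powr - \<nu>"
    proof -
      have "1 + - \<nu> = al + k / 2" by (simp add: \<nu>_def)
      from powr_mult_base[of "x * y" "- \<nu>", unfolded this] assms show ?thesis by simp
    qed
    finally show ?thesis
      using * by (simp add: mult_ac)
  next
    case False
    have "(1 + y / x) powr k - 1 - (y / x) powr k \<le> (2 powr k - 2) * (y / x)"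
      using assms False by (intro powr_sum_defect_le_linear) auto
    then have "x powr k * ((1 + y / x) powr k - 1 - (y / x) powr k) \<le> x powr k * ((2 powr k - 2) * (y / x))"
      by (intro mult_left_mono) auto
    also have "x powr k * ((1 + y / x) powr k - 1 - (y / x) powr k) = (x + y) powr k - x powr k - y powr k"
      using assms by (simp add: right_diff_distrib powr_mult[symmetric] distrib_left)
    also have "x powr k * ((2 powr k - 2) * (y / x)) = (2 powr k - 2) * (x powr (k - 1) * y)"
      using assms by (simp add: powr_diff)
    finally have "kern al be x y * (\<phi> (x + y) - \<phi> x - \<phi> y) \<le> kern al be x y * ((2 powr k - 2) * (x powr (k - 1) * y))"
      unfolding \<phi> by (intro mult_left_mono) auto
    also have "\<dots> \<le> 2 powr be * ((x * x) powr al * x powr be) * ((2 powr k - 2) * (x powr (k - 1) * y))"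
      unfolding kern using assms al be two_powr_k by (intro mult_right_mono mult_left_mono mult_mono powr_mono2) auto
    also have "\<dots> = 2 powr be * (2 powr k - 2) * (x powr (1 + (2 * al + be + k - 2)) * y)"
    proof -
      have "x powr (1 + (2 * al + be + k - 2)) = (x * x) powr al * x powr be * x powr (k - 1)"
        unfolding powr_mult powr_add[symmetric] by (simp add: algebra_simps)
      then show ?thesis by (simp add: mult_ac)
    qed
    also have "\<dots> = 2 powr be * (2 powr k - 2) * (x * y) * x powr (2 * al + be + k - 2)"
      unfolding powr_add using assms by (simp add: mult_ac)
    also have "\<dots> \<le> 2 powr be * (2 powr k - 2) * (x * y) * ((\<tau> x + 1) / 2)"
      using growth_1[of x] assms two_powr_k by (intro mult_left_mono) auto
    finally show ?thesis .
  qed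
qed

text \<open>Where \<open>\<phi>\<close> is linear up to \<open>x + y\<close>, the defect vanishes.
  If only the sum exceeds \<open>1\<close>, the chord of the power over \<open>{1..2}\<close> is
  used. If \<open>y < 1 \<le> x\<close>, convexity in \<open>y\<close> reduces to
  \<open>y = 1\<close>, which \<open>defect_ge_1\<close> covers.\<close>

lemma defect_unit:
  assumes "0 < y" "y \<le> x"
  shows "kern al be x y * (\<phi> (x + y) - \<phi> x - \<phi> y) \<le> 2 powr be * (2 powr k - 2) * (x * y) * ((\<tau> x + 1) / 2)"
proof -
  have nn: "0 \<le> 2 powr be * (2 powr k - 2) * (x * y)"
    using two_powr_k assms by auto
  consider "x + y \<le> 1" | "x < 1" "x + y > 1" | "y \<ge> 1" | "y < 1" "x \<ge> 1"
    using assms by linarith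
  then show ?thesis
  proof cases
    case 1
    then have "\<phi> (x + y) - \<phi> x - \<phi> y = 0"
      using assms by (simp add: test_fun_le)
    then show ?thesis
      using mult_nonneg_nonneg[OF nn, of "(\<tau> x + 1) / 2"] \<tau>_ge_1[of x] by simp
  next
    case 2
    define S where "S = x + y"
    have S: "1 < S" "S \<le> 2" using 2 assms by (auto simp: S_def)
    have "S powr k \<le> (1 - (S - 1)) * 1 powr k + (S - 1) * 2 powr k"
      using convex_onD[OF powr_convex[of k], of "S - 1" 1 2] S k by simp
    then have "S powr k - S \<le> (2 powr k - 2) * (S - 1)"
      by (simp add: algebra_simps)
    \<comment> \<open>The inequality \<open>x + y - 1 \<le> x * y\<close> is
      \<open>(1 - x) * (1 - y) \<ge> 0\<close>.\<close>
    also have "\<dots> \<le> (2 powr k - 2) * (x * y)"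
      using two_powr_k mult_nonneg_nonneg[of "1 - x" "1 - y"] 2 assms
      by (intro mult_left_mono) (auto simp: S_def algebra_simps)
    finally have "\<phi> (x + y) - \<phi> x - \<phi> y \<le> (2 powr k - 2) * (x * y)"
      using 2 assms S by (simp add: test_fun_le test_fun_ge S_def)
    then have "kern al be x y * (\<phi> (x + y) - \<phi> x - \<phi> y) \<le> kern al be x y * ((2 powr k - 2) * (x * y))"
      by (intro mult_left_mono) auto
    also have "\<dots> \<le> (1 * 1 * 2 powr be) * ((2 powr k - 2) * (x * y))"
      unfolding kern_def using 2 assms al be two_powr_k
      by (intro mult_right_mono mult_mono powr_le1 powr_mono2) auto
    also have "\<dots> = 2 powr be * (2 powr k - 2) * (x * y) * 1"
      by simp
    also have "\<dots> \<le> 2 powr be * (2 powr k - 2) * (x * y) * ((\<tau> x + 1) / 2)"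
      using nn \<tau>_ge_1[of x] by (intro mult_left_mono) auto
    finally show ?thesis .
  next
    case 3
    then show ?thesis using defect_ge_1 assms by blast
  next
    case 4
    have "(x + y) powr k \<le> (1 - y) * x powr k + y * (x + 1) powr k"
      using convex_onD[OF powr_convex[of k], of y x "x + 1"] 4 assms k by (simp add: algebra_simps)
    then have "\<phi> (x + y) - \<phi> x - \<phi> y \<le> y * (\<phi> (x + 1) - \<phi> x - \<phi> 1)"
      using 4 assms by (simp add: test_fun_le test_fun_ge algebra_simps)
    moreover have "0 \<le> \<phi> (x + y) - \<phi> x - \<phi> y"
      using test_fun_superadditive[of x y k 1] assms k by simp
    moreover have "kern al be x y \<le> kern al be x 1"
      unfolding kern_def using 4 assms al be by (intro mult_mono powr_mono2) (auto simp: powr_le1)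
    ultimately have "kern al be x y * (\<phi> (x + y) - \<phi> x - \<phi> y) \<le> kern al be x 1 * (y * (\<phi> (x + 1) - \<phi> x - \<phi> 1))"
      by (intro mult_mono) auto
    also have "\<dots> = y * (kern al be x 1 * (\<phi> (x + 1) - \<phi> x - \<phi> 1))"
      by simp
    also have "\<dots> \<le> y * (2 powr be * (2 powr k - 2) * (x * 1) * ((\<tau> x + 1) / 2))"
      using defect_ge_1[of 1 x] 4 assms by (intro mult_left_mono) auto
    finally show ?thesis by (simp add: mult_ac)
  qed
qed

text \<open>Homogeneity moves the threshold from \<open>1\<close> to \<open>a\<close>: the kernel
  has degree \<open>2 * al + be\<close>, the test function (scaled with its threshold) degree
  \<open>k\<close>. Raising the summand \<open>1\<close> of \<open>defect_unit\<close> to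
  \<open>\<tau> (y / a)\<close> makes the bound symmetric, so the order of \<open>x\<close> and
  \<open>y\<close> no longer matters and double sums factor.\<close>

lemma defect_symmetric:
  assumes "a > 0" "x > 0" "y > 0"
  shows "kern al be x y * (test_fun k a (x + y) - test_fun k a x - test_fun k a y)
    \<le> 2 powr be * (2 powr k - 2) * a powr (2 * al + be + k - 2) * (x * y) * ((\<tau> (x / a) + \<tau> (y / a)) / 2)"
    (is "?L x y \<le> ?R x y")
proof -
  have *: "?L x y \<le> ?R x y" if "0 < y" "y \<le> x" for x y
  proof -
    have tf: "test_fun k a z = a powr k * \<phi> (z / a)" if "z > 0" for z
    proof -
      have "max z a = a * max (z / a) 1"
        using assms(1) by (simp add: max_def field_simps)
      moreover have "a powr k = a * a powr (k - 1)"
        using assms(1) by (simp add: powr_diff)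
      ultimately show ?thesis
        using assms(1) by (simp add: test_fun_def powr_mult)
    qed
    have kern: "kern al be x y = a powr (2 * al + be) * kern al be (x / a) (y / a)"
    proof -
      have "a powr (2 * al + be) = a powr al * a powr al * a powr be"
        unfolding powr_add[symmetric] by simp
      then show ?thesis
        unfolding kern_def add_divide_distrib[symmetric] powr_divide using assms(1) by simp
    qed
    have "?L x y = (a powr (2 * al + be) * a powr k) *
        (kern al be (x / a) (y / a) * (\<phi> ((x + y) / a) - \<phi> (x / a) - \<phi> (y / a)))"
      using that by (subst kern) (simp add: tf algebra_simps)
    then have "?L x y = a powr (2 * al + be + k) *
        (kern al be (x / a) (y / a) * (\<phi> (x / a + y / a) - \<phi> (x / a) - \<phi> (y / a)))"
      unfolding powr_add add_divide_distrib .
    also have "\<dots> \<le> a powr (2 * al + be + k) *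
        (2 powr be * (2 powr k - 2) * (x / a * (y / a)) * ((\<tau> (x / a) + 1) / 2))"
      using defect_unit[of "y / a" "x / a"] that assms(1)
      by (intro mult_left_mono) (auto simp: divide_right_mono)
    also have "\<dots> \<le> a powr (2 * al + be + k) *
        (2 powr be * (2 powr k - 2) * (x / a * (y / a)) * ((\<tau> (x / a) + \<tau> (y / a)) / 2))"
      using two_powr_k \<tau>_ge_1[of "y / a"] that assms(1) by (intro mult_left_mono) auto
    also have "\<dots> = ?R x y"
    proof -
      have "a powr (2 * al + be + k) = a powr (2 * al + be + k - 2) * (a * a)"
        using assms(1) by (simp add: powr_diff power2_eq_square)
      then show ?thesis
        using assms(1) by simp
    qed
    finally show ?thesis .
  qed
  show ?thesis
  proof (cases "y \<le> x")
    case True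
    then show ?thesis using * assms by blast
  next
    case False
    then have "?L y x \<le> ?R y x" using * assms by auto
    moreover have "?L y x = ?L x y"
      by (simp add: kern_commute[of _ _ y x] add.commute[of y x] diff_right_commute)
    moreover have "?R y x = ?R x y"
      by (simp only: mult.commute[of y x] add.commute)
    ultimately show ?thesis by (simp only:)
  qed
qed

end

section \<open>Weak forms of the merging and splitting operators\<close>

lemma has_sum_diff_real:
  fixes f g :: "'a \<Rightarrow> real"
  assumes "(f has_sum a) A" "(g has_sum b) A"
  shows "((\<lambda>x. f x - g x) has_sum (a - b)) A"
  using has_sum_add[OF assms(1), of "\<lambda>x. - g x" "- b"] assms(2) by (simp add: has_sum_uminus)

lemma has_sum_nonneg_product:
  fixes f :: "'a \<Rightarrow> real" and g :: "'b \<Rightarrow> real"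
  assumes "(f has_sum s) A" "(g has_sum t) B"
    and "\<And>x. x \<in> A \<Longrightarrow> f x \<ge> 0" "\<And>y. y \<in> B \<Longrightarrow> g y \<ge> 0"
  shows "((\<lambda>(x, y). f x * g y) has_sum s * t) (A \<times> B)"
proof (rule has_sum_SigmaI)
  show "((\<lambda>y. case (x, y) of (x, y) \<Rightarrow> f x * g y) has_sum f x * t) B" for x
    using has_sum_cmult_right[OF assms(2), of "f x"] by simp
  show "((\<lambda>x. f x * t) has_sum s * t) A"
    using assms(1) by (rule has_sum_cmult_left)
  then show "(\<lambda>(x, y). f x * g y) summable_on A \<times> B"
    using has_sum_cmult_right[OF assms(2)] assms(3,4)
    by (intro summable_on_SigmaI[where g = "\<lambda>x. f x * t"]) (auto simp: summable_on_def)
qed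

text \<open>A bound by sums of products of powers, so that double sums over pairs are controlled by
  products of moments.\<close>

lemma kern_le:
  assumes "a \<ge> 0" "b \<ge> 0" "x > 0" "y > 0"
  shows "kern a b x y \<le> 2 powr b * (x powr (a + b) * y powr a + x powr a * y powr (a + b))"
proof -
  have "(x + y) powr b \<le> 2 powr b * (x powr b + y powr b)"
  proof (cases "x \<le> y")
    case True
    then have "(x + y) powr b \<le> (2 * y) powr b" using assms by (intro powr_mono2) auto
    also have "\<dots> \<le> 2 powr b * (x powr b + y powr b)" by (simp add: powr_mult)
    finally show ?thesis .
  next
    case False
    then have "(x + y) powr b \<le> (2 * x) powr b" using assms by (intro powr_mono2) auto
    also have "\<dots> \<le> 2 powr b * (x powr b + y powr b)" by (simp add: powr_mult)
    finally show ?thesis .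
  qed
  from mult_left_mono[OF this, of "x powr a * y powr a"] show ?thesis
    by (simp add: kern_def powr_add algebra_simps)
qed

lemma kern_fragment_le:
  assumes "a \<ge> 0" "0 < y" "y < x"
  shows "kern a b (x - y) y \<le> x powr (a + b) * y powr a"
proof -
  have "(x - y) powr a * (x powr b * y powr a) \<le> x powr a * (x powr b * y powr a)"
    using assms by (intro mult_right_mono powr_mono2) auto
  then show ?thesis by (simp add: kern_def powr_add mult_ac)
qed

section \<open>Moments and double sums of a nonnegative profile\<close>

locale profile =
  fixes h \<kappa> :: real and f :: "nat \<Rightarrow> real"
  assumes h: "h > 0" and f_nonneg: "i \<ge> 1 \<Longrightarrow> f i \<ge> 0" and fin: "finite_moment h \<kappa> f"
begin

abbreviation xx :: "nat \<Rightarrow> real" where "xx i \<equiv> real i * h"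

lemma xx_pos: "i \<ge> 1 \<Longrightarrow> xx i > 0"
  using h by simp

text \<open>All sizes are at least \<open>h\<close>, so on the grid a lower power is bounded by a
  multiple of a higher one.\<close>

lemma term_le:
  assumes "p \<le> \<kappa>" "i \<ge> 1"
  shows "f i * xx i powr p \<le> h powr (p - \<kappa>) * (f i * xx i powr \<kappa>)"
proof -
  have "xx i powr (p - \<kappa>) \<le> h powr (p - \<kappa>)"
    using assms h by (intro powr_mono2') auto
  from mult_right_mono[OF this, of "f i * xx i powr \<kappa>"]
  have "xx i powr (p - \<kappa>) * (f i * xx i powr \<kappa>) \<le> h powr (p - \<kappa>) * (f i * xx i powr \<kappa>)"
    using f_nonneg[OF assms(2)] by simp
  moreover have "xx i powr (p - \<kappa>) * (f i * xx i powr \<kappa>) = f i * xx i powr p"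
    using xx_pos[OF assms(2)] unfolding powr_diff by simp
  ultimately show ?thesis by simp
qed

lemma finite_moment_le: "p \<le> \<kappa> \<Longrightarrow> finite_moment h p f"
  unfolding finite_moment_def
  by (rule summable_on_comparison_test[where f = "\<lambda>i. h powr (p - \<kappa>) * (f i * xx i powr \<kappa>)"])
    (use fin f_nonneg term_le in \<open>auto simp: finite_moment_def intro: summable_on_cmult_right\<close>)

lemma has_moment: "p \<le> \<kappa> \<Longrightarrow> ((\<lambda>i. f i * xx i powr p) has_sum moment h p f) {1..}"
  using finite_moment_le by (simp add: finite_moment_def moment_def)

lemma moment_nonneg: "moment h p f \<ge> 0"
  unfolding moment_def using f_nonneg by (intro infsum_nonneg) auto

lemma moment_le:
  assumes "p \<le> \<kappa>"
  shows "moment h p f \<le> h powr (p - \<kappa>) * moment h \<kappa> f"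
  by (rule has_sum_mono[OF has_moment[OF assms] has_sum_cmult_right[OF has_moment]])
    (use assms term_le in auto)

lemma pair_moments:
  assumes "p \<le> \<kappa>" "q \<le> \<kappa>"
  shows "((\<lambda>(i, j). (f i * xx i powr p) * (f j * xx j powr q)) has_sum moment h p f * moment h q f) ({1..} \<times> {1..})"
  using assms f_nonneg by (intro has_sum_nonneg_product has_moment) auto

abbreviation pairs :: "(nat \<times> nat) set" where "pairs \<equiv> {1..} \<times> {1..}"
text \<open>The first index is the size that breaks up. The set \<open>frags'\<close> is the
  transpose of \<open>frags\<close>, over which the infinite sums of \<open>S_split\<close>
  run.\<close>

abbreviation frags :: "(nat \<times> nat) set" where "frags \<equiv> Sigma {1..} (\<lambda>i. {1..<i})"
abbreviation frags' :: "(nat \<times> nat) set" where "frags' \<equiv> Sigma {1..} (\<lambda>i. {i<..})"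

definition coag :: "real \<Rightarrow> real \<Rightarrow> nat \<times> nat \<Rightarrow> real" where
  "coag a b = (\<lambda>(i, j). kern a b (xx i) (xx j) * f i * f j)"

definition frag :: "real \<Rightarrow> real \<Rightarrow> nat \<times> nat \<Rightarrow> real" where
  "frag a b = (\<lambda>(i, j). kern a b (real (i - j) * h) (xx j) * f i * f j)"

lemma coag_nonneg: "p \<in> pairs \<Longrightarrow> coag a b p \<ge> 0"
  using f_nonneg by (auto simp: coag_def)

lemma frag_nonneg: "p \<in> pairs \<Longrightarrow> frag a b p \<ge> 0"
  using f_nonneg by (auto simp: frag_def)

lemma coag_summable:
  assumes "a \<ge> 0" "b \<ge> 0" "a + b \<le> \<kappa>"
  shows "coag a b summable_on pairs"
proof -
  have "(\<lambda>p. 2 powr b * ((\<lambda>(i, j). (f i * xx i powr (a + b)) * (f j * xx j powr a)) p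
      + (\<lambda>(i, j). (f i * xx i powr a) * (f j * xx j powr (a + b))) p)) summable_on pairs"
    using assms by (intro summable_on_cmult_right summable_on_add has_sum_imp_summable[OF pair_moments]) auto
  then show ?thesis
  proof (rule summable_on_comparison_test)
    fix p assume p: "p \<in> pairs"
    obtain i j where ij: "p = (i, j)" "i \<ge> 1" "j \<ge> 1" using p by auto
    have "kern a b (xx i) (xx j) * (f i * f j) \<le> 2 powr b * (xx i powr (a + b) * xx j powr a + xx i powr a * xx j powr (a + b)) * (f i * f j)"
      using ij assms h f_nonneg by (intro mult_right_mono kern_le) auto
    then show "coag a b p \<le> 2 powr b * ((\<lambda>(i, j). (f i * xx i powr (a + b)) * (f j * xx j powr a)) p
      + (\<lambda>(i, j). (f i * xx i powr a) * (f j * xx j powr (a + b))) p)"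
      by (simp add: coag_def ij algebra_simps)
  qed (use coag_nonneg in auto)
qed

lemma frag_le:
  assumes "a \<ge> 0" "(i, j) \<in> frags"
  shows "frag a b (i, j) \<le> (f i * xx i powr (a + b)) * (f j * xx j powr a)"
proof -
  have "kern a b (xx i - xx j) (xx j) \<le> xx i powr (a + b) * xx j powr a"
    using assms h by (intro kern_fragment_le) auto
  then have "kern a b (xx i - xx j) (xx j) * (f i * f j) \<le> xx i powr (a + b) * xx j powr a * (f i * f j)"
    using assms f_nonneg by (intro mult_right_mono) auto
  moreover have eq: "real (i - j) * h = xx i - xx j"
    using assms by (simp add: of_nat_diff left_diff_distrib)
  ultimately show ?thesis
    unfolding frag_def prod.case eq by (simp add: mult_ac)
qed

lemma frags_subset: "frags \<subseteq> pairs"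
  by auto

lemma frag_summable:
  assumes "a \<ge> 0" "b \<ge> 0" "a + b \<le> \<kappa>"
  shows "frag a b summable_on frags"
proof (rule summable_on_comparison_test)
  show "(\<lambda>(i, j). (f i * xx i powr (a + b)) * (f j * xx j powr a)) summable_on frags"
    using assms by (intro summable_on_subset[OF has_sum_imp_summable[OF pair_moments] frags_subset]) auto
qed (use frag_le frag_nonneg frags_subset assms in auto)

lemma bounded_weight_summable:
  fixes g :: "nat \<times> nat \<Rightarrow> real"
  assumes "g summable_on P" "\<And>p. p \<in> P \<Longrightarrow> g p \<ge> 0" "\<And>p. p \<in> P \<Longrightarrow> \<bar>w p\<bar> \<le> M"
  shows "(\<lambda>p. w p * g p) summable_on P"
proof -
  have "(\<lambda>p. norm (w p * g p)) summable_on P"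
    by (rule Infinite_Sum.abs_summable_on_comparison_test'[OF summable_on_cmult_right[OF assms(1), of M]])
      (use assms(2,3) in \<open>auto simp: abs_mult intro!: mult_right_mono\<close>)
  then show ?thesis by (rule abs_summable_summable)
qed

text \<open>The bounded weight keeps all double sums absolutely convergent, so they may be
  rearranged. The gain is reindexed by the pair of merging sizes.\<close>

lemma merge_weak_form:
  assumes ab: "a \<ge> 0" "b \<ge> 0" "a + b \<le> \<kappa>" and w: "\<And>i. \<bar>w i\<bar> \<le> M"
  shows "((\<lambda>i. w i * S_merge h a b f i) has_sum
    (\<Sum>\<^sub>\<infinity>(i, j)\<in>pairs. (w (i + j) - w i - w j) * coag a b (i, j))) {1..}"
proof -
  note S = coag_summable[OF ab]
  have ws: "(\<lambda>p. v p * coag a b p) summable_on pairs" if "\<And>p. \<bar>v p\<bar> \<le> M" for v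
    using S coag_nonneg that by (intro bounded_weight_summable[where M = M]) auto
  define G where "G v = (\<Sum>\<^sub>\<infinity>p\<in>pairs. v p * coag a b p)" for v
  have G: "((\<lambda>p. v p * coag a b p) has_sum G v) pairs" if "\<And>p. \<bar>v p\<bar> \<le> M" for v
    unfolding G_def using ws[OF that] by simp
  have gain: "((\<lambda>i. w i * (\<Sum>j\<in>{1..<i}. kern a b (xx j) (real (i - j) * h) * f j * f (i - j)))
      has_sum G (\<lambda>(i, j). w (i + j))) {1..}"
  proof (rule has_sum_SigmaD)
    show "((\<lambda>(i, j). w i * coag a b (j, i - j)) has_sum G (\<lambda>(i, j). w (i + j))) frags"
      by (rule has_sum_reindex_bij_witness[where i = "\<lambda>(i, j). (j, i - j)" and j = "\<lambda>(i, j). (i + j, i)",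
            THEN iffD1, OF _ _ _ _ _ refl G[of "\<lambda>(i, j). w (i + j)"]]) (use w in auto)
    show "((\<lambda>j. case (i, j) of (i, j) \<Rightarrow> w i * coag a b (j, i - j)) has_sum
      w i * (\<Sum>j\<in>{1..<i}. kern a b (xx j) (real (i - j) * h) * f j * f (i - j))) {1..<i}" for i
      by (intro has_sum_finiteI) (auto simp: coag_def sum_distrib_left)
  qed
  have loss: "((\<lambda>i. w i * (\<Sum>\<^sub>\<infinity>j\<in>{1..}. kern a b (xx i) (xx j) * f i * f j)) has_sum G (\<lambda>(i, j). w i)) {1..}"
  proof (rule has_sum_SigmaD)
    show "((\<lambda>(i, j). w i * coag a b (i, j)) has_sum G (\<lambda>(i, j). w i)) pairs"
      using G[of "\<lambda>(i, j). w i"] w by (simp add: case_prod_unfold)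
    show "((\<lambda>j. case (i, j) of (i, j) \<Rightarrow> w i * coag a b (i, j)) has_sum
      w i * (\<Sum>\<^sub>\<infinity>j\<in>{1..}. kern a b (xx i) (xx j) * f i * f j)) {1..}" if "i \<in> {1..}" for i
      using summable_on_SigmaD1[of "\<lambda>i j. coag a b (i, j)" "{1..}" "\<lambda>_. {1..}" i] S that
      by (auto simp: coag_def case_prod_unfold intro!: has_sum_cmult_right)
  qed
  \<comment> \<open>By symmetry of the kernel, the factor \<open>2\<close> of the loss becomes
    \<open>w i + w j\<close>.\<close>
  have sym: "G (\<lambda>(i, j). w j) = G (\<lambda>(i, j). w i)"
    unfolding G_def
    by (rule infsum_reindex_bij_witness[where i = "\<lambda>(i, j). (j, i)" and j = "\<lambda>(i, j). (j, i)"])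
      (auto simp: coag_def kern_commute)
  have "((\<lambda>p. (\<lambda>(i, j). w (i + j)) p * coag a b p - (\<lambda>(i, j). w i) p * coag a b p - (\<lambda>(i, j). w j) p * coag a b p) has_sum
      G (\<lambda>(i, j). w (i + j)) - G (\<lambda>(i, j). w i) - G (\<lambda>(i, j). w j)) pairs"
    using w by (intro has_sum_diff_real G) auto
  then have "(\<Sum>\<^sub>\<infinity>(i, j)\<in>pairs. (w (i + j) - w i - w j) * coag a b (i, j)) =
      G (\<lambda>(i, j). w (i + j)) - 2 * G (\<lambda>(i, j). w i)"
    unfolding sym by (intro infsumI) (simp add: case_prod_unfold left_diff_distrib)
  moreover have "((\<lambda>i. w i * S_merge h a b f i) has_sum G (\<lambda>(i, j). w (i + j)) - 2 * G (\<lambda>(i, j). w i)) {1..}"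
    using has_sum_diff_real[OF gain has_sum_cmult_right[OF loss, of 2]]
    by (simp add: S_merge_def right_diff_distrib mult_ac)
  ultimately show ?thesis by simp
qed

text \<open>The finite sum is already indexed by \<open>frags\<close>. The first infinite sum
  becomes so by transposition, the second by transposition and the reflection of \<open>j\<close> to
  \<open>i - j\<close>, which exchanges the two fragments.\<close>

lemma split_weak_form:
  assumes ab: "a \<ge> 0" "b \<ge> 0" "a + b \<le> \<kappa>" and w: "\<And>i. \<bar>w i\<bar> \<le> M"
  shows "((\<lambda>i. w i * S_split h a b f i) has_sum
    (\<Sum>\<^sub>\<infinity>(i, j)\<in>frags. (w j + w (i - j) - w i) * frag a b (i, j))) {1..}"
proof -
  note S = frag_summable[OF ab]
  have ws: "(\<lambda>p. v p * frag a b p) summable_on frags" if "\<And>p. \<bar>v p\<bar> \<le> M" for v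
    using S frag_nonneg that by (intro bounded_weight_summable[where M = M]) auto
  define G where "G v = (\<Sum>\<^sub>\<infinity>p\<in>frags. v p * frag a b p)" for v
  have G: "((\<lambda>p. v p * frag a b p) has_sum G v) frags" if "\<And>p. \<bar>v p\<bar> \<le> M" for v
    unfolding G_def using ws[OF that] by simp
  have swap: "((\<lambda>(i, j). g (j, i)) has_sum s) frags'" if "(g has_sum s) frags" for g :: "nat \<times> nat \<Rightarrow> real" and s
    by (rule has_sum_reindex_bij_witness[where i = "\<lambda>(i, j). (j, i)" and j = "\<lambda>(i, j). (j, i)",
          THEN iffD1, OF _ _ _ _ _ refl that]) auto
  have reflect: "((\<lambda>(i, j). g (i, i - j)) has_sum s) frags" if "(g has_sum s) frags" for g :: "nat \<times> nat \<Rightarrow> real" and s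
    by (rule has_sum_reindex_bij_witness[where i = "\<lambda>(i, j). (i, i - j)" and j = "\<lambda>(i, j). (i, i - j)",
          THEN iffD1, OF _ _ _ _ _ refl that]) auto
  have row: "(\<lambda>j. g (i, j)) summable_on {i<..}" if "(\<lambda>(i, j). g (i, j)) summable_on frags'" "i \<in> {1..}"
    for g :: "nat \<times> nat \<Rightarrow> real" and i
    using summable_on_SigmaD1[of "\<lambda>i j. g (i, j)" "{1..}" "\<lambda>i. {i<..}" i] that by simp
  have 1: "((\<lambda>i. w i * (\<Sum>j\<in>{1..<i}. kern a b (real (i - j) * h) (xx j) * f i * f j)) has_sum G (\<lambda>(i, j). w i)) {1..}"
  proof (rule has_sum_SigmaD)
    show "((\<lambda>(i, j). w i * frag a b (i, j)) has_sum G (\<lambda>(i, j). w i)) frags"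
      using G[of "\<lambda>(i, j). w i"] w by (simp add: case_prod_unfold)
    show "((\<lambda>j. case (i, j) of (i, j) \<Rightarrow> w i * frag a b (i, j)) has_sum
      w i * (\<Sum>j\<in>{1..<i}. kern a b (real (i - j) * h) (xx j) * f i * f j)) {1..<i}" for i
      by (intro has_sum_finiteI) (auto simp: frag_def sum_distrib_left)
  qed
  have 2: "((\<lambda>i. w i * (\<Sum>\<^sub>\<infinity>j\<in>{i<..}. kern a b (real (j - i) * h) (xx i) * f i * f j)) has_sum G (\<lambda>(i, j). w j)) {1..}"
  proof (rule has_sum_SigmaD)
    show "((\<lambda>(i, j). w i * frag a b (j, i)) has_sum G (\<lambda>(i, j). w j)) frags'"
      using swap[OF G[of "\<lambda>(i, j). w j"]] w by (simp add: case_prod_unfold)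
    show "((\<lambda>j. case (i, j) of (i, j) \<Rightarrow> w i * frag a b (j, i)) has_sum
      w i * (\<Sum>\<^sub>\<infinity>j\<in>{i<..}. kern a b (real (j - i) * h) (xx i) * f i * f j)) {i<..}" if "i \<in> {1..}" for i
    proof -
      have "(\<lambda>j. frag a b (j, i)) summable_on {i<..}"
        using row[of "\<lambda>(i, j). frag a b (j, i)" i] swap[OF has_sum_infsum[OF S]] that
        by (auto simp: summable_on_def)
      then have "((\<lambda>j. kern a b (real (j - i) * h) (xx i) * f i * f j) has_sum
          (\<Sum>\<^sub>\<infinity>j\<in>{i<..}. kern a b (real (j - i) * h) (xx i) * f i * f j)) {i<..}"
        by (simp add: frag_def mult_ac)
      from has_sum_cmult_right[OF this, of "w i"] show ?thesis
        by (simp add: frag_def mult_ac)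
    qed
  qed
  have 3: "((\<lambda>i. w i * (\<Sum>\<^sub>\<infinity>j\<in>{i<..}. kern a b (xx i) (real (j - i) * h) * f j * f (j - i))) has_sum G (\<lambda>(i, j). w (i - j))) {1..}"
  proof (rule has_sum_SigmaD)
    have "((\<lambda>(i, j). w j * frag a b (i, i - j)) has_sum G (\<lambda>(i, j). w (i - j))) frags"
      by (rule has_sum_cong[THEN iffD1, OF _ reflect[OF G[of "\<lambda>(i, j). w (i - j)"]]]) (use w in auto)
    then show "((\<lambda>(i, j). w i * frag a b (j, j - i)) has_sum G (\<lambda>(i, j). w (i - j))) frags'"
      using swap[of "\<lambda>(i, j). w j * frag a b (i, i - j)"] by simp
    show "((\<lambda>j. case (i, j) of (i, j) \<Rightarrow> w i * frag a b (j, j - i)) has_sum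
      w i * (\<Sum>\<^sub>\<infinity>j\<in>{i<..}. kern a b (xx i) (real (j - i) * h) * f j * f (j - i))) {i<..}" if "i \<in> {1..}" for i
    proof -
      have "(\<lambda>j. frag a b (j, j - i)) summable_on {i<..}"
        using row[of "\<lambda>(i, j). frag a b (j, j - i)" i]
          swap[OF reflect[OF has_sum_infsum[OF S]]] that
        by (auto simp: summable_on_def)
      moreover have eq: "frag a b (j, j - i) = kern a b (xx i) (real (j - i) * h) * f j * f (j - i)" if "j \<in> {i<..}" for j
        using that by (simp add: frag_def)
      ultimately have "((\<lambda>j. kern a b (xx i) (real (j - i) * h) * f j * f (j - i)) has_sum
          (\<Sum>\<^sub>\<infinity>j\<in>{i<..}. kern a b (xx i) (real (j - i) * h) * f j * f (j - i))) {i<..}"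
        using summable_on_cong[of "{i<..}", OF eq] by simp
      from has_sum_cmult_right[OF this, of "w i"] show ?thesis
        by (rule has_sum_cong[THEN iffD1, rotated]) (simp add: eq)
    qed
  qed
  have "((\<lambda>p. (\<lambda>(i, j). w j) p * frag a b p + (\<lambda>(i, j). w (i - j)) p * frag a b p - (\<lambda>(i, j). w i) p * frag a b p) has_sum
      G (\<lambda>(i, j). w j) + G (\<lambda>(i, j). w (i - j)) - G (\<lambda>(i, j). w i)) frags"
    using w by (intro has_sum_diff_real has_sum_add G) auto
  then have "(\<Sum>\<^sub>\<infinity>(i, j)\<in>frags. (w j + w (i - j) - w i) * frag a b (i, j)) =
      G (\<lambda>(i, j). w j) + G (\<lambda>(i, j). w (i - j)) - G (\<lambda>(i, j). w i)"
    by (intro infsumI) (simp add: case_prod_unfold left_diff_distrib distrib_right)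
  moreover have "((\<lambda>i. w i * S_split h a b f i) has_sum
      G (\<lambda>(i, j). w j) + G (\<lambda>(i, j). w (i - j)) - G (\<lambda>(i, j). w i)) {1..}"
    using has_sum_diff_real[OF has_sum_add[OF 2 3] 1]
    by (simp add: S_split_def right_diff_distrib distrib_left algebra_simps)
  ultimately show ?thesis by simp
qed

end

section \<open>Evolution of the truncated moments\<close>

text \<open>While \<open>v = u - \<beta>\<close> is positive, superadditivity of the power gives
  \<open>v' \<le> - v powr (1 + r) / 2\<close>, so \<open>v powr - r\<close> grows at rate at least
  \<open>r / 2\<close>. The resulting bound does not involve the initial value.\<close>

lemma powr_decay_ode:
  fixes u u' :: "real \<Rightarrow> real" and \<beta> r :: real
  assumes "r > 0" "\<beta> \<ge> 0"
    and der: "\<And>t. t > 0 \<Longrightarrow> (u has_real_derivative u' t) (at t)"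
    and le: "\<And>t. t > 0 \<Longrightarrow> u' t \<le> (\<beta> powr (1 + r) - u t powr (1 + r)) / 2"
    and "t > 0"
  shows "u t \<le> (2 / (r * t)) powr (1 / r) + \<beta>"
proof (rule ccontr)
  assume "\<not> ?thesis"
  then have big: "u t - \<beta> > (2 / (r * t)) powr (1 / r)" by simp
  then have ut: "u t > \<beta>" using powr_ge_zero[of "2 / (r * t)" "1 / r"] by linarith
  have cont: "continuous_on {s..t} u" if "s > 0" for s
  proof (rule DERIV_continuous_on)
    show "(u has_real_derivative u' x) (at x within {s..t})" if "x \<in> {s..t}" for x
      using der[of x] that \<open>s > 0\<close> by (simp add: has_field_derivative_at_within)
  qed
  \<comment> \<open>If \<open>u\<close> were at most \<beta> at some time, consider the last such
    time before \<open>t\<close>: from there on \<open>u\<close> is nonincreasing and cannot end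
    above \<beta>.\<close>
  have above: "u s > \<beta>" if s: "0 < s" "s \<le> t" for s
  proof (rule ccontr)
    assume "\<not> u s > \<beta>"
    define S where "S = {s..t} \<inter> u -` {..\<beta>}"
    have "closed S"
      unfolding S_def using cont[OF s(1)] by (intro continuous_closed_preimage) auto
    moreover have "bounded S"
      unfolding S_def by (rule bounded_subset[of "{s..t}"]) auto
    ultimately have "compact S"
      by (simp add: compact_eq_bounded_closed)
    moreover have "s \<in> S" using \<open>\<not> u s > \<beta>\<close> s by (auto simp: S_def)
    ultimately obtain m where m: "m \<in> S" "\<And>y. y \<in> S \<Longrightarrow> y \<le> m"
      using compact_attains_sup[of S] by blast
    then have m': "s \<le> m" "m \<le> t" "u m \<le> \<beta>" by (auto simp: S_def)
    then have "m < t" "m > 0" using ut s by (auto simp: less_le)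
    have gt: "u y > \<beta>" if "m < y" "y \<le> t" for y
      by (rule ccontr) (use m(2)[of y] that m' in \<open>auto simp: S_def\<close>)
    obtain z where z: "m < z" "z < t" "u t - u m = (t - m) * u' z"
    proof (rule exE[OF MVT2[of m t u u']])
      show "(u has_real_derivative u' x) (at x)" if "m \<le> x" for x
        using that \<open>m > 0\<close> by (intro der) simp
    qed (use \<open>m < t\<close> in auto)
    have "\<beta> powr (1 + r) \<le> u z powr (1 + r)"
      using gt[of z] z assms by (intro powr_mono2) auto
    then have "u' z \<le> 0" using le[of z] z \<open>m > 0\<close> by simp
    then have "(t - m) * u' z \<le> 0" using z by (intro mult_nonneg_nonpos) auto
    then have "u t \<le> u m" using z(3) by simp
    with ut m'(3) show False by simp
  qed
  define g where "g = (\<lambda>s. (u s - \<beta>) powr - r - r / 2 * s)"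
  have incr: "g s \<le> g t" if s: "0 < s" "s \<le> t" for s
  proof (rule DERIV_nonneg_imp_nondecreasing[of s t g])
    fix y assume "s \<le> y" "y \<le> t"
    then have y: "y > 0" "u y > \<beta>" using above s by auto
    have 1: "(g has_real_derivative (- r * (u y - \<beta>) powr (- r - 1) * u' y - r / 2)) (at y)"
      unfolding g_def using y by (auto intro!: derivative_eq_intros der simp: powr_diff)
    have "(u y - \<beta>) powr (1 + r) + \<beta> powr (1 + r) \<le> u y powr (1 + r)"
      using powr_superadditive[of "u y - \<beta>" \<beta> "1 + r"] y assms by simp
    then have "(u y - \<beta>) powr (1 + r) / 2 \<le> - ((\<beta> powr (1 + r) - u y powr (1 + r)) / 2)"
      by (simp add: field_simps)
    also have "\<dots> \<le> - u' y"
      using le[OF y(1)] by (rule le_imp_neg_le)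
    finally have "(u y - \<beta>) powr (1 + r) / 2 \<le> - u' y" .
    then have "r * (u y - \<beta>) powr (- r - 1) * ((u y - \<beta>) powr (1 + r) / 2) \<le> r * (u y - \<beta>) powr (- r - 1) * (- u' y)"
      using assms by (intro mult_left_mono) auto
    moreover have "(u y - \<beta>) powr (- r - 1) * (u y - \<beta>) powr (1 + r) = 1"
      using y by (simp add: powr_add[symmetric])
    ultimately have "0 \<le> - r * (u y - \<beta>) powr (- r - 1) * u' y - r / 2"
      by (simp add: mult.assoc)
    with 1 show "\<exists>d. (g has_real_derivative d) (at y) \<and> 0 \<le> d" by (intro exI conjI)
  qed (use s in simp)
  have "r / 2 * (t - s) \<le> (u t - \<beta>) powr - r" if "0 < s" "s \<le> t" for s
  proof -
    have "r / 2 * (t - s) \<le> (u t - \<beta>) powr - r - (u s - \<beta>) powr - r"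
      using incr[OF that] by (simp add: g_def right_diff_distrib)
    also have "\<dots> \<le> (u t - \<beta>) powr - r" by simp
    finally show ?thesis .
  qed
  \<comment> \<open>Nothing is assumed about \<open>u\<close> at \<open>0\<close>, so the integrated
    inequality is taken from \<open>s > 0\<close> and \<open>s\<close> tends to
    \<open>0\<close>.\<close>
  then have "r / 2 * t \<le> (u t - \<beta>) powr - r"
  proof -
    have "((\<lambda>s. r / 2 * (t - s)) \<longlongrightarrow> r / 2 * (t - 0)) (at_right 0)"
      by (intro tendsto_intros)
    moreover have "eventually (\<lambda>s. r / 2 * (t - s) \<le> (u t - \<beta>) powr - r) (at_right 0)"
      unfolding eventually_at_right_field
      using \<open>t > 0\<close> \<open>\<And>s. 0 < s \<Longrightarrow> s \<le> t \<Longrightarrow> r / 2 * (t - s) \<le> (u t - \<beta>) powr - r\<close>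
      by (intro exI[of _ t]) auto
    ultimately show ?thesis
      using tendsto_upperbound by fastforce
  qed
  also have "\<dots> < ((2 / (r * t)) powr (1 / r)) powr - r"
    using big assms \<open>t > 0\<close> by (intro powr_less_mono2_neg) auto
  also have "\<dots> = r * t / 2"
    using assms \<open>t > 0\<close> by (simp add: powr_powr powr_minus)
  finally show False by simp
qed

section \<open>Bounded weights as functionals on \<open>l1\<close>\<close>

lemma bounded_weight_abs_summable:
  fixes g w :: "nat \<Rightarrow> real"
  assumes "g \<in> l1" "\<And>i. \<bar>w i\<bar> \<le> M"
  shows "(\<lambda>i. \<bar>w i * g i\<bar>) summable_on {1..}"
proof (rule summable_on_comparison_test)
  show "(\<lambda>i. M * \<bar>g i\<bar>) summable_on {1..}"
    using assms(1) by (intro summable_on_cmult_right) (simp add: l1_def)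
  show "\<bar>w i * g i\<bar> \<le> M * \<bar>g i\<bar>" for i
    unfolding abs_mult using assms(2) by (intro mult_right_mono) simp_all
qed simp

lemma bounded_weight_summable_l1:
  fixes g w :: "nat \<Rightarrow> real"
  assumes "g \<in> l1" "\<And>i. \<bar>w i\<bar> \<le> M"
  shows "(\<lambda>i. w i * g i) summable_on {1..}"
  using bounded_weight_abs_summable[OF assms] abs_summable_summable[of "\<lambda>i. w i * g i" "{1..}"] by simp

lemma bounded_weight_infsum_le:
  fixes g w :: "nat \<Rightarrow> real"
  assumes "g \<in> l1" "\<And>i. \<bar>w i\<bar> \<le> M"
  shows "\<bar>\<Sum>\<^sub>\<infinity>i\<in>{1..}. w i * g i\<bar> \<le> M * l1_norm g"
proof -
  have "\<bar>\<Sum>\<^sub>\<infinity>i\<in>{1..}. w i * g i\<bar> \<le> (\<Sum>\<^sub>\<infinity>i\<in>{1..}. \<bar>w i * g i\<bar>)"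
    using norm_infsum_bound[of "\<lambda>i. w i * g i" "{1..}"] bounded_weight_abs_summable[OF assms] by simp
  also have "\<dots> \<le> (\<Sum>\<^sub>\<infinity>i\<in>{1..}. M * \<bar>g i\<bar>)"
  proof (rule infsum_mono)
    show "(\<lambda>i. \<bar>w i * g i\<bar>) summable_on {1..}"
      by (rule bounded_weight_abs_summable[OF assms])
    show "(\<lambda>i. M * \<bar>g i\<bar>) summable_on {1..}"
      using assms(1) by (intro summable_on_cmult_right) (simp add: l1_def)
    show "\<bar>w i * g i\<bar> \<le> M * \<bar>g i\<bar>" for i
      unfolding abs_mult using assms(2) by (intro mult_right_mono) simp_all
  qed
  also have "\<dots> = M * l1_norm g"
    by (simp add: l1_norm_def infsum_cmult_right')
  finally show ?thesis .
qed

lemma l1_lincomb: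
  assumes "f \<in> l1" "g \<in> l1" "k \<in> l1"
  shows "(\<lambda>i. (f i - g i) / c - k i) \<in> l1"
proof -
  have "(\<lambda>i. (\<bar>f i\<bar> + \<bar>g i\<bar>) * (1 / \<bar>c\<bar>) + \<bar>k i\<bar>) summable_on {1..}"
    using assms by (intro summable_on_add summable_on_cmult_left) (auto simp: l1_def)
  then have "(\<lambda>i. \<bar>(f i - g i) / c - k i\<bar>) summable_on {1..}"
  proof (rule summable_on_comparison_test)
    fix i
    have "\<bar>(f i - g i) / c\<bar> \<le> (\<bar>f i\<bar> + \<bar>g i\<bar>) * (1 / \<bar>c\<bar>)"
      by (simp add: divide_right_mono abs_triangle_ineq4)
    then show "\<bar>(f i - g i) / c - k i\<bar> \<le> (\<bar>f i\<bar> + \<bar>g i\<bar>) * (1 / \<bar>c\<bar>) + \<bar>k i\<bar>"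
      by linarith
  qed simp
  then show ?thesis by (simp add: l1_def)
qed

text \<open>A bounded weight defines a continuous linear functional on \<open>l1\<close>, which
  commutes with differentiation in norm.\<close>

lemma bounded_weight_has_derivative:
  assumes C1: "C1_l1 f f'" and w: "\<And>i. \<bar>w i\<bar> \<le> M" and t: "t > 0"
  shows "((\<lambda>s. \<Sum>\<^sub>\<infinity>i\<in>{1..}. w i * f s i) has_real_derivative (\<Sum>\<^sub>\<infinity>i\<in>{1..}. w i * f' t i)) (at t)"
proof -
  define Y where "Y s = (\<Sum>\<^sub>\<infinity>i\<in>{1..}. w i * f s i)" for s
  define Y' where "Y' = (\<Sum>\<^sub>\<infinity>i\<in>{1..}. w i * f' t i)"
  have l1: "f s \<in> l1" "f' s \<in> l1" if "s \<ge> 0" for s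
    using C1 that by (auto simp: C1_l1_def)
  have lim: "((\<lambda>s. M * l1_norm (\<lambda>i. (f s i - f t i) / (s - t) - f' t i)) \<longlongrightarrow> M * 0) (at t within {0..})"
    using C1 t by (intro tendsto_mult_left) (auto simp: C1_l1_def)
  have "((\<lambda>s. (Y s - Y t) / (s - t) - Y') \<longlongrightarrow> 0) (at t within {0..})"
  proof (rule Lim_null_comparison)
    show "((\<lambda>s. M * l1_norm (\<lambda>i. (f s i - f t i) / (s - t) - f' t i)) \<longlongrightarrow> 0) (at t within {0..})"
      using lim by simp
    show "\<forall>\<^sub>F s in at t within {0..}. norm ((Y s - Y t) / (s - t) - Y')
        \<le> M * l1_norm (\<lambda>i. (f s i - f t i) / (s - t) - f' t i)"
      unfolding eventually_at_filter
    proof (intro always_eventually allI impI)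
      fix s :: real assume "s \<noteq> t" "s \<in> {0..}"
      then have s: "f s \<in> l1" "f t \<in> l1" "f' t \<in> l1" using l1 t by auto
      have "((\<lambda>i. (w i * f s i - w i * f t i) * (1 / (s - t)) - w i * f' t i) has_sum (Y s - Y t) * (1 / (s - t)) - Y') {1..}"
        unfolding Y_def Y'_def using bounded_weight_summable_l1[OF _ w] s
        by (intro has_sum_diff_real has_sum_cmult_left has_sum_infsum) auto
      then have "(Y s - Y t) / (s - t) - Y' = (\<Sum>\<^sub>\<infinity>i\<in>{1..}. w i * ((f s i - f t i) / (s - t) - f' t i))"
        by (intro infsumI[symmetric]) (simp add: right_diff_distrib diff_divide_distrib)
      then show "norm ((Y s - Y t) / (s - t) - Y') \<le> M * l1_norm (\<lambda>i. (f s i - f t i) / (s - t) - f' t i)"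
        using bounded_weight_infsum_le[OF l1_lincomb[OF s] w] by simp
    qed
  qed
  then have "((\<lambda>s. (Y s - Y t) / (s - t)) \<longlongrightarrow> Y') (at t within {0..})"
    by (rule LIM_zero_cancel)
  moreover have "at t within {0..} = at t"
    using t by (intro at_within_interior) simp
  ultimately show ?thesis
    unfolding has_field_derivative_iff Y_def Y'_def by simp
qed

section \<open>Absorption of the gains by the loss\<close>

context merge_bound
begin

text \<open>An identity for \<open>A \<le> x\<close>: the growing part of the gain takes half of the
  loss, and the other half stays as damping. For \<open>x < A\<close> the loss is estimated by
  \<open>0\<close>, and the \<open>- 1\<close> in \<open>\<tau>\<close> yields the damping
  \<open>A powr e\<close>.\<close>

lemma absorbed_small:
  assumes "A > 0" "x > 0"
  shows "c * A powr e / 2 * \<tau> (x / A) - x powr \<delta> * max x A powr (k - 1)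
    \<le> A powr e * b0 / 2 - (max x A powr (k - 1)) powr (1 + \<delta> / (k - 1)) / 2"
proof -
  have "(k - 1) * (1 + \<delta> / (k - 1)) = e"
    using k by (simp add: field_simps)
  then have p: "(max x A powr (k - 1)) powr (1 + \<delta> / (k - 1)) = max x A powr e"
    by (simp add: powr_powr)
  show ?thesis
  proof (cases "A \<le> x")
    case True
    then have "c * A powr e / 2 * \<tau> (x / A) = (A powr e * b0 + x powr e) / 2"
      using assms c_pos by (simp add: \<tau>_def powr_divide field_simps)
    moreover have "x powr \<delta> * x powr (k - 1) = x powr e"
      by (simp add: powr_add[symmetric] algebra_simps)
    ultimately show ?thesis
      unfolding p using True by (simp add: max_absorb1 add_divide_distrib)
  next
    case False
    then have "c * A powr e / 2 * \<tau> (x / A) = A powr e * b0 / 2 - A powr e / 2"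
      using assms c_pos by (simp add: \<tau>_def field_simps)
    moreover have "0 \<le> x powr \<delta> * A powr (k - 1)" by simp
    ultimately show ?thesis
      unfolding p using False by (simp add: max_absorb2 diff_divide_distrib)
  qed
qed

lemma absorbed_large:
  assumes "A > 0" "A \<le> y" "y \<le> x"
  shows "x * (test_fun k A y / x) powr (1 + \<delta> / (k - 1)) \<le> test_fun k A y * x powr \<delta>"
proof -
  have \<delta>0: "\<delta> > 0" using al be \<delta> by simp
  have W: "test_fun k A y = y * y powr (k - 1)" "test_fun k A y > 0"
    using assms by (simp_all add: test_fun_def max_absorb1)
  have "test_fun k A y / x \<le> y powr (k - 1)"
    unfolding W(1) using assms by (simp add: pos_divide_le_eq mult.commute mult_left_mono)
  then have "(test_fun k A y / x) powr (\<delta> / (k - 1)) \<le> (y powr (k - 1)) powr (\<delta> / (k - 1))"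
    using \<delta>0 k W(2) assms by (intro powr_mono2) auto
  also have "\<dots> = y powr \<delta>"
    using k by (simp add: powr_powr)
  also have "\<dots> \<le> x powr \<delta>"
    using assms \<delta>0 by (intro powr_mono2) auto
  finally have "test_fun k A y * (test_fun k A y / x) powr (\<delta> / (k - 1)) \<le> test_fun k A y * x powr \<delta>"
    using W(2) by (intro mult_left_mono) auto
  moreover have "x * (test_fun k A y / x) powr (1 + \<delta> / (k - 1)) = test_fun k A y * (test_fun k A y / x) powr (\<delta> / (k - 1))"
    using W(2) assms unfolding powr_add by simp
  ultimately show ?thesis by simp
qed

end

text \<open>The equation \<open>AX\<close> fixes the threshold \<open>A\<close> so that the
  amplitude of \<open>defect_symmetric\<close> times \<open>X\<close> is the factor
  \<open>c * A powr e / 2\<close> of \<open>absorbed_small\<close>. The condition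
  \<open>tail\<close> lets half of the loss beyond \<open>N\<close> pay for splitting.\<close>

locale truncated_moment =
  merge_bound al be \<delta> k c + profile h \<kappa> f
  for al be \<delta> k c h \<kappa> f +
  fixes X A al2 be2 al3 be3 :: real and N :: nat
  assumes pars: "al2 > 0" "be2 > 0" "al2 + be2 < \<delta>" "al3 > 0" "be3 > 0" "al3 + be3 < \<delta>"
    and \<kappa>: "\<delta> \<le> \<kappa>" "1 \<le> \<kappa>"
    and X: "X > 0" "moment h 1 f \<le> X"
    and A: "A > 0"
    and AX: "2 powr (be + 1) * (2 powr k - 2) * A powr (2 * al + be + k - 2) * X = c * A powr (\<delta> + k - 1)"
    and N: "A \<le> real N * h"
    and tail: "i > N \<Longrightarrow> moment h al2 f * (real i * h) powr (al2 + be2)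
      + moment h al3 f * (real i * h) powr (al3 + be3) \<le> (real i * h) powr \<delta> / 2"
begin

text \<open>Constant weights beyond \<open>N\<close> keep the test sequence bounded, as needed to differentiate in \<open>l1\<close>.\<close>

definition w :: "nat \<Rightarrow> real" where "w i = test_fun k A (real (min i N) * h)"

lemma w_nonneg: "w i \<ge> 0"
  using h by (simp add: w_def test_fun_nonneg)

lemma w_mono: "i \<le> j \<Longrightarrow> w i \<le> w j"
  unfolding w_def using h k A by (intro test_fun_mono mult_right_mono) auto

lemma w_le: "w i \<le> w N"
  using w_mono[of "min i N" N] by (simp add: w_def)

lemma w_abs_le: "\<bar>w i\<bar> \<le> w N"
  using w_nonneg w_le by simp

lemma w_small: "i \<le> N \<Longrightarrow> w i = test_fun k A (xx i)"
  by (simp add: w_def)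

lemma w_large: "i \<ge> N \<Longrightarrow> w i = w N"
  by (simp add: w_def)

lemma w_superadditive: "i + j \<le> N \<Longrightarrow> w i + w j \<le> w (i + j)"
  using test_fun_superadditive[of "xx i" "xx j" k A] h k A by (simp add: w_small distrib_right)

lemma moment_1: "((\<lambda>i. f i * xx i) has_sum moment h 1 f) {1..}"
  by (rule has_sum_cong[THEN iffD1, OF _ has_moment[OF \<kappa>(2)]]) (use h in simp)

text \<open>A pair with a member beyond \<open>N\<close> contributes nothing positive, as the sum
  has the same frozen weight as that member. On the remaining square the symmetric bound yields two
  equal products, in each of which one factor is a partial sum of the first moment.\<close>

lemma merge_le:
  "(\<Sum>\<^sub>\<infinity>(i, j)\<in>pairs. (w (i + j) - w i - w j) * coag al be (i, j))
    \<le> c * A powr e / 2 * (\<Sum>i\<in>{1..N}. f i * xx i * \<tau> (xx i / A))"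
proof -
  define C where "C = 2 powr be * (2 powr k - 2) * A powr (2 * al + be + k - 2)"
  define T where "T i = \<tau> (xx i / A)" for i
  define u where "u i = f i * xx i" for i
  have C: "C \<ge> 0" "C * X = c * A powr e / 2"
    using two_powr_k AX by (simp_all add: C_def powr_add)
  have T: "T i \<ge> 1" for i by (simp add: T_def \<tau>_ge_1)
  have u: "u i \<ge> 0" if "i \<in> {1..N}" for i
    using that f_nonneg h by (simp add: u_def)
  have double_sum: "(\<Sum>i\<in>{1..N}. \<Sum>j\<in>{1..N}. d * (p i * q j)) = d * ((\<Sum>i\<in>{1..N}. p i) * (\<Sum>j\<in>{1..N}. q j))"
    for d :: real and p q :: "nat \<Rightarrow> real"
    by (subst sum_product) (simp only: sum_distrib_left)
  have "(\<Sum>\<^sub>\<infinity>(i, j)\<in>pairs. (w (i + j) - w i - w j) * coag al be (i, j))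
      \<le> (\<Sum>\<^sub>\<infinity>(i, j)\<in>{1..N} \<times> {1..N}. C * (u i * u j) * ((T i + T j) / 2))"
  proof (rule infsum_mono_neutral)
    have "\<bar>w (i + j) - w i - w j\<bar> \<le> 3 * w N" for i j
      using w_abs_le[of "i + j"] w_abs_le[of i] w_abs_le[of j] by linarith
    then have "(\<lambda>p. (\<lambda>(i, j). w (i + j) - w i - w j) p * coag al be p) summable_on pairs"
      using coag_nonneg coag_summable[of al be] al be \<delta> \<kappa>
      by (intro bounded_weight_summable[where M = "3 * w N"]) auto
    then show "(\<lambda>(i, j). (w (i + j) - w i - w j) * coag al be (i, j)) summable_on pairs"
      by (simp add: case_prod_unfold)
    fix p assume p: "p \<in> pairs \<inter> {1..N} \<times> {1..N}"
    obtain i j where ij: "p = (i, j)" "i \<ge> 1" "i \<le> N" "j \<ge> 1" "j \<le> N" using p by auto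
    have "w (i + j) \<le> test_fun k A (xx i + xx j)"
      unfolding w_def using h k A ij by (intro test_fun_mono) (auto simp: distrib_right[symmetric] mult_right_mono)
    then have "kern al be (xx i) (xx j) * (w (i + j) - w i - w j)
        \<le> kern al be (xx i) (xx j) * (test_fun k A (xx i + xx j) - test_fun k A (xx i) - test_fun k A (xx j))"
      using ij by (intro mult_left_mono) (auto simp: w_small)
    also have "\<dots> \<le> C * (xx i * xx j) * ((T i + T j) / 2)"
      unfolding C_def T_def using A ij xx_pos by (intro defect_symmetric) auto
    finally have "kern al be (xx i) (xx j) * (w (i + j) - w i - w j) * (f i * f j)
      \<le> C * (xx i * xx j) * ((T i + T j) / 2) * (f i * f j)"
      using f_nonneg ij by (intro mult_right_mono) auto
    then show "(\<lambda>(i, j). (w (i + j) - w i - w j) * coag al be (i, j)) p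
      \<le> (\<lambda>(i, j). C * (u i * u j) * ((T i + T j) / 2)) p"
      by (simp add: ij coag_def u_def mult_ac)
  next
    fix p assume p: "p \<in> pairs - {1..N} \<times> {1..N}"
    obtain i j where ij: "p = (i, j)" "i \<ge> 1" "j \<ge> 1" "i > N \<or> j > N" using p by fastforce
    have "w (i + j) - w i - w j \<le> 0"
      using ij w_large[of "i + j"] w_large[of i] w_large[of j] w_nonneg[of i] w_nonneg[of j] by auto
    then show "(\<lambda>(i, j). (w (i + j) - w i - w j) * coag al be (i, j)) p \<le> 0"
      using coag_nonneg[of "(i, j)"] ij by (simp add: mult_nonpos_nonneg)
  qed auto
  also have "\<dots> = (\<Sum>i\<in>{1..N}. \<Sum>j\<in>{1..N}. C * (u i * u j) * ((T i + T j) / 2))"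
    by (simp add: sum.cartesian_product)
  also have "\<dots> = (\<Sum>i\<in>{1..N}. \<Sum>j\<in>{1..N}. C / 2 * (u i * T i * u j)) + (\<Sum>i\<in>{1..N}. \<Sum>j\<in>{1..N}. C / 2 * (u i * (u j * T j)))"
    unfolding sum.distrib[symmetric] by (intro sum.cong refl) (simp add: algebra_simps)
  also have "\<dots> = C / 2 * ((\<Sum>i\<in>{1..N}. u i * T i) * (\<Sum>i\<in>{1..N}. u i)) + C / 2 * ((\<Sum>i\<in>{1..N}. u i) * (\<Sum>i\<in>{1..N}. u i * T i))"
    unfolding double_sum ..
  also have "\<dots> = C * (\<Sum>i\<in>{1..N}. u i) * (\<Sum>i\<in>{1..N}. u i * T i)"
    by (simp add: algebra_simps)
  also have "\<dots> \<le> C * X * (\<Sum>i\<in>{1..N}. u i * T i)"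
  proof (intro mult_right_mono mult_left_mono)
    have "(\<Sum>i\<in>{1..N}. u i) \<le> moment h 1 f"
      unfolding u_def using f_nonneg h by (intro finite_sum_le_has_sum[OF moment_1]) auto
    then show "(\<Sum>i\<in>{1..N}. u i) \<le> X" using X(2) by simp
    show "0 \<le> (\<Sum>i\<in>{1..N}. u i * T i)"
    proof (rule sum_nonneg)
      show "0 \<le> u i * T i" if "i \<in> {1..N}" for i
        using u[OF that] T[of i] by simp
    qed
  qed (rule C)
  finally show ?thesis
    unfolding C(2) u_def T_def .
qed

text \<open>Up to size \<open>N\<close> superadditivity makes the contribution nonpositive. Beyond
  \<open>N\<close> each of the two fragments has weight at most \<open>w N\<close>, and one
  \<open>w N\<close> cancels against the weight of the parent.\<close>

lemma split_le:
  assumes "a > 0" "b > 0" "a + b < \<delta>"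
  shows "(\<Sum>\<^sub>\<infinity>(i, j)\<in>frags. (w j + w (i - j) - w i) * frag a b (i, j))
    \<le> w N * ((\<Sum>\<^sub>\<infinity>i\<in>{N<..}. f i * xx i powr (a + b)) * moment h a f)"
proof -
  define g where "g = (\<lambda>(i, j). (f i * xx i powr (a + b)) * (f j * xx j powr a))"
  have "((\<lambda>i. f i * xx i powr (a + b)) has_sum (\<Sum>\<^sub>\<infinity>i\<in>{N<..}. f i * xx i powr (a + b))) {N<..}"
    using assms \<kappa> by (intro has_sum_infsum summable_on_subset[OF has_sum_imp_summable[OF has_moment]]) auto
  then have "(g has_sum ((\<Sum>\<^sub>\<infinity>i\<in>{N<..}. f i * xx i powr (a + b)) * moment h a f)) ({N<..} \<times> {1..})"
    unfolding g_def using assms \<kappa> f_nonneg by (intro has_sum_nonneg_product has_moment) auto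
  then have maj: "((\<lambda>p. w N * g p) has_sum (w N * ((\<Sum>\<^sub>\<infinity>i\<in>{N<..}. f i * xx i powr (a + b)) * moment h a f))) ({N<..} \<times> {1..})"
    by (rule has_sum_cmult_right)
  have "(\<Sum>\<^sub>\<infinity>(i, j)\<in>frags. (w j + w (i - j) - w i) * frag a b (i, j)) \<le> (\<Sum>\<^sub>\<infinity>p\<in>{N<..} \<times> {1..}. w N * g p)"
  proof (rule infsum_mono_neutral)
    have "\<bar>w j + w (i - j) - w i\<bar> \<le> 3 * w N" for i j
      using w_abs_le[of "i - j"] w_abs_le[of i] w_abs_le[of j] by linarith
    then have "(\<lambda>p. (\<lambda>(i, j). w j + w (i - j) - w i) p * frag a b p) summable_on frags"
      using frag_nonneg frag_summable[of a b] assms \<kappa>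
      by (intro bounded_weight_summable[where M = "3 * w N"]) auto
    then show "(\<lambda>(i, j). (w j + w (i - j) - w i) * frag a b (i, j)) summable_on frags"
      by (simp add: case_prod_unfold)
    show "(\<lambda>p. w N * g p) summable_on {N<..} \<times> {1..}"
      using maj by (rule has_sum_imp_summable)
    fix p assume p: "p \<in> frags \<inter> {N<..} \<times> {1..}"
    obtain i j where ij: "p = (i, j)" "(i, j) \<in> frags" "i > N" using p by auto
    have "(w j + w (i - j) - w i) * frag a b (i, j) \<le> w N * g (i, j)"
    proof (rule mult_mono)
      show "w j + w (i - j) - w i \<le> w N"
        using w_large[of i] w_le[of j] w_le[of "i - j"] ij by simp
      show "frag a b (i, j) \<le> g (i, j)"
        unfolding g_def prod.case using assms ij by (intro frag_le) auto
      show "0 \<le> frag a b (i, j)" using ij by (intro frag_nonneg) auto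
    qed (rule w_nonneg)
    then show "(\<lambda>(i, j). (w j + w (i - j) - w i) * frag a b (i, j)) p \<le> w N * g p"
      by (simp add: ij)
  next
    fix p assume p: "p \<in> frags - {N<..} \<times> {1..}"
    obtain i j where "p = (i, j)" by (cases p)
    with p have ij: "p = (i, j)" "(i, j) \<in> frags" "i \<le> N" by auto
    have "w j + w (i - j) \<le> w i"
      using w_superadditive[of j "i - j"] ij by simp
    moreover have "frag a b (i, j) \<ge> 0" using ij by (intro frag_nonneg) auto
    ultimately show "(\<lambda>(i, j). (w j + w (i - j) - w i) * frag a b (i, j)) p \<le> 0"
      by (simp add: ij mult_nonpos_nonneg)
  next
    fix p assume "p \<in> {N<..} \<times> {1..} - frags"
    then show "0 \<le> w N * g p"
      using w_nonneg f_nonneg by (auto simp: g_def)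
  qed
  also have "\<dots> = w N * ((\<Sum>\<^sub>\<infinity>i\<in>{N<..}. f i * xx i powr (a + b)) * moment h a f)"
    using maj by (rule infsumI)
  finally show ?thesis .
qed

end

context truncated_moment
begin

definition Y :: real where "Y = (\<Sum>\<^sub>\<infinity>i\<in>{1..}. w i * f i)"

lemma has_Y: "((\<lambda>i. w i * f i) has_sum Y) {1..}"
proof -
  have "f summable_on {1..}"
  proof (rule summable_on_cong[THEN iffD1])
    show "(\<lambda>i. f i * xx i powr 0) summable_on {1..}"
      using finite_moment_le[of 0] \<kappa> by (simp add: finite_moment_def)
  qed (use h in simp)
  then have "(\<lambda>i. w N * f i) summable_on {1..}"
    by (rule summable_on_cmult_right)
  then have "(\<lambda>i. w i * f i) summable_on {1..}"
    by (rule summable_on_comparison_test) (use w_nonneg w_le f_nonneg in \<open>auto intro: mult_right_mono\<close>)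
  then show ?thesis by (simp add: Y_def)
qed

text \<open>The bounds of \<open>merge_le\<close> and \<open>split_le\<close> are set against the
  loss size by size. Up to \<open>N\<close> this is \<open>absorbed_small\<close>; beyond
  \<open>N\<close>, half of the loss pays for splitting and the other half gives the damping by
  \<open>absorbed_large\<close>.\<close>

lemma weighted_loss_bound:
  assumes "i \<ge> 1"
  shows "(if i \<le> N then c * A powr (\<delta> + k - 1) / 2 * (f i * xx i * \<tau> (xx i / A))
      else w N * (f i * (moment h al2 f * xx i powr (al2 + be2) + moment h al3 f * xx i powr (al3 + be3))))
      - w i * ((real i * h) powr \<delta> * f i)
    \<le> (f i * xx i) * (A powr (\<delta> + k - 1) * b0 / 2 - (w i / xx i) powr (1 + \<delta> / (k - 1)) / 2)"
proof (cases "i \<le> N")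
  case True
  have x: "xx i > 0" using assms xx_pos by simp
  have wi: "w i = xx i * max (xx i) A powr (k - 1)"
    using True by (simp add: w_small test_fun_def)
  then have wi_div: "w i / xx i = max (xx i) A powr (k - 1)"
    using nonzero_mult_div_cancel_left[OF less_imp_neq[OF x, symmetric]] by simp
  have "(f i * xx i) * (c * A powr (\<delta> + k - 1) / 2 * \<tau> (xx i / A) - xx i powr \<delta> * max (xx i) A powr (k - 1))
    \<le> (f i * xx i) * (A powr (\<delta> + k - 1) * b0 / 2 - (max (xx i) A powr (k - 1)) powr (1 + \<delta> / (k - 1)) / 2)"
    using x f_nonneg[OF assms] A by (intro mult_left_mono absorbed_small) auto
  moreover have "e * (f i * xx i * t) - xx i * m * (d * f i) = f i * xx i * (e * t - d * m)" for e t m d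
    by (simp add: algebra_simps)
  note this[of "c * A powr (\<delta> + k - 1) / 2" "\<tau> (xx i / A)" "max (xx i) A powr (k - 1)" "xx i powr \<delta>"]
  ultimately show ?thesis
    unfolding wi_div unfolding wi using True by (simp only: if_True)
next
  case False
  have x: "xx i > 0" using assms xx_pos by simp
  have wi: "w i = w N" "w N = test_fun k A (xx N)"
    using False w_large[of i] w_small[of N] by simp_all
  have fi: "f i \<ge> 0" using f_nonneg assms by simp
  have "w N * f i * (moment h al2 f * xx i powr (al2 + be2) + moment h al3 f * xx i powr (al3 + be3))
      \<le> w N * f i * (xx i powr \<delta> / 2)"
  proof (rule mult_left_mono)
    show "moment h al2 f * xx i powr (al2 + be2) + moment h al3 f * xx i powr (al3 + be3) \<le> xx i powr \<delta> / 2"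
      using False by (intro tail) simp
    show "0 \<le> w N * f i" using w_nonneg fi by simp
  qed
  moreover have "f i * (xx i * (w N / xx i) powr (1 + \<delta> / (k - 1))) \<le> f i * (w N * xx i powr \<delta>)"
  proof (rule mult_left_mono[OF _ fi])
    have "xx N \<le> xx i" using False h by (intro mult_right_mono) auto
    then show "xx i * (w N / xx i) powr (1 + \<delta> / (k - 1)) \<le> w N * xx i powr \<delta>"
      unfolding wi(2) by (rule absorbed_large[OF A N])
  qed
  moreover have "0 \<le> f i * xx i * (A powr (\<delta> + k - 1) * b0 / 2)"
    using fi less_imp_le[OF x] h b0_ge c_pos by (intro mult_nonneg_nonneg divide_nonneg_nonneg) auto
  moreover have "v * (g * s) - v * (d * g) \<le> g * x * (b - p / 2)"
    if "v * g * s \<le> v * g * (d / 2)" "g * (x * p) \<le> g * (v * d)" "0 \<le> g * x * b" for v g s d x p b :: real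
    using that by (simp add: algebra_simps)
  ultimately show ?thesis
    unfolding wi(1) using False by (simp only: if_False)
qed

text \<open>Summing \<open>weighted_loss_bound\<close> leaves a sum of
  \<open>(w i / xx i) powr (1 + r)\<close> with weights \<open>f i * xx i\<close>; convexity bounds
  it below in terms of \<open>Y\<close>, which closes the differential inequality.\<close>

lemma weighted_operator_le:
  "(\<Sum>\<^sub>\<infinity>i\<in>{1..}. w i * (S_merge h al be f i + S_split h al2 be2 f i + S_split h al3 be3 f i - V_op h \<delta> f i))
    \<le> X / 2 * (A powr (\<delta> + k - 1) * b0 - (Y / X) powr (1 + \<delta> / (k - 1)))"
proof -
  define r where "r = \<delta> / (k - 1)"
  have r: "r > 0" using al be \<delta> k by (simp add: r_def)
  define E where "E = A powr (\<delta> + k - 1)"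
  define M1 M2 M3 where "M1 = (\<Sum>\<^sub>\<infinity>(i, j)\<in>pairs. (w (i + j) - w i - w j) * coag al be (i, j))"
    and "M2 = (\<Sum>\<^sub>\<infinity>(i, j)\<in>frags. (w j + w (i - j) - w i) * frag al2 be2 (i, j))"
    and "M3 = (\<Sum>\<^sub>\<infinity>(i, j)\<in>frags. (w j + w (i - j) - w i) * frag al3 be3 (i, j))"
  define L2 L3 where "L2 = (\<Sum>\<^sub>\<infinity>i\<in>{N<..}. f i * xx i powr (al2 + be2))"
    and "L3 = (\<Sum>\<^sub>\<infinity>i\<in>{N<..}. f i * xx i powr (al3 + be3))"
  define V where "V = (\<Sum>\<^sub>\<infinity>i\<in>{1..}. w i * V_op h \<delta> f i)"
  define G where "G = (\<Sum>i\<in>{1..N}. f i * xx i * \<tau> (xx i / A))"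
  have hV: "((\<lambda>i. w i * V_op h \<delta> f i) has_sum V) {1..}"
  proof -
    have "(\<lambda>i. w N * (f i * xx i powr \<delta>)) summable_on {1..}"
      using has_sum_imp_summable[OF has_moment[OF \<kappa>(1)]] by (rule summable_on_cmult_right)
    then have "(\<lambda>i. w i * V_op h \<delta> f i) summable_on {1..}"
      by (rule summable_on_comparison_test)
        (use w_nonneg w_le f_nonneg in \<open>auto simp: V_op_def mult.commute[of "f _"] intro!: mult_right_mono\<close>)
    then show ?thesis by (simp add: V_def)
  qed
  have "((\<lambda>i. w i * S_merge h al be f i + w i * S_split h al2 be2 f i + w i * S_split h al3 be3 f i - w i * V_op h \<delta> f i)
      has_sum (M1 + M2 + M3 - V)) {1..}"
    unfolding M1_def M2_def M3_def using al be \<delta> pars \<kappa>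
    by (intro has_sum_diff_real has_sum_add merge_weak_form[where M = "w N"] split_weak_form[where M = "w N"] w_abs_le hV) auto
  then have "(\<Sum>\<^sub>\<infinity>i\<in>{1..}. w i * (S_merge h al be f i + S_split h al2 be2 f i + S_split h al3 be3 f i - V_op h \<delta> f i)) = M1 + M2 + M3 - V"
    by (intro infsumI) (simp add: algebra_simps)
  also have "\<dots> \<le> c * E / 2 * G + w N * (L2 * moment h al2 f + L3 * moment h al3 f) - V"
    using merge_le split_le[OF pars(1-3)] split_le[OF pars(4-6)]
    unfolding M1_def M2_def M3_def L2_def L3_def G_def E_def by (simp add: distrib_left)
  also have "\<dots> \<le> E * b0 / 2 * moment h 1 f - ((1 + r) * (Y / X) powr r * Y - r * (Y / X) powr (1 + r) * moment h 1 f) / 2"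
  proof (rule has_sum_mono)
    define g1 where "g1 i = (if i \<le> N then c * E / 2 * (f i * xx i * \<tau> (xx i / A)) else 0)" for i
    define g2 where "g2 i = (if i \<le> N then 0 else w N * (f i * (moment h al2 f * xx i powr (al2 + be2) + moment h al3 f * xx i powr (al3 + be3))))" for i
    have "(g1 has_sum c * E / 2 * G) {1..}"
      unfolding G_def sum_distrib_left
      by (rule has_sum_finite_neutralI[of "{1..N}"]) (auto simp: g1_def)
    moreover have "(g2 has_sum w N * (L2 * moment h al2 f + L3 * moment h al3 f)) {1..}"
    proof -
      have L: "((\<lambda>i. f i * xx i powr p) has_sum (\<Sum>\<^sub>\<infinity>i\<in>{N<..}. f i * xx i powr p)) {N<..}" if "p \<le> \<kappa>" for p
        by (intro has_sum_infsum summable_on_subset[OF has_sum_imp_summable[OF has_moment[OF that]]]) auto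
      have "((\<lambda>i. w N * (f i * xx i powr (al2 + be2) * moment h al2 f + f i * xx i powr (al3 + be3) * moment h al3 f))
        has_sum w N * (L2 * moment h al2 f + L3 * moment h al3 f)) {N<..}"
        unfolding L2_def L3_def using pars \<kappa> by (intro has_sum_cmult_right has_sum_add has_sum_cmult_left L) auto
      then show ?thesis
        by (rule has_sum_cong_neutral[THEN iffD1, rotated -1]) (auto simp: g2_def algebra_simps)
    qed
    ultimately show "((\<lambda>i. g1 i + g2 i - w i * V_op h \<delta> f i) has_sum
        (c * E / 2 * G + w N * (L2 * moment h al2 f + L3 * moment h al3 f) - V)) {1..}"
      by (intro has_sum_diff_real has_sum_add hV)
    show "((\<lambda>i. E * b0 / 2 * (f i * xx i) - ((1 + r) * (Y / X) powr r * (w i * f i) - r * (Y / X) powr (1 + r) * (f i * xx i)) * (1 / 2))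
      has_sum (E * b0 / 2 * moment h 1 f - ((1 + r) * (Y / X) powr r * Y - r * (Y / X) powr (1 + r) * moment h 1 f) / 2)) {1..}"
      using has_sum_diff_real[OF has_sum_cmult_right[OF moment_1, of "E * b0 / 2"]
          has_sum_cmult_left[OF has_sum_diff_real[OF has_sum_cmult_right[OF has_Y, of "(1 + r) * (Y / X) powr r"]
            has_sum_cmult_right[OF moment_1, of "r * (Y / X) powr (1 + r)"]], of "1 / 2"]] by simp
    fix i :: nat assume "i \<in> {1..}"
    then have i: "i \<ge> 1" by simp
    have x: "xx i > 0" "f i \<ge> 0" using i xx_pos f_nonneg by auto
    \<comment> \<open>The tangent is taken at \<open>Y / X\<close> instead of the true mean because
      the first moment may be smaller than \<open>X\<close>.\<close>
    have "(1 + r) * (Y / X) powr r * (w i / xx i) - r * (Y / X) powr (1 + r) \<le> (w i / xx i) powr (1 + r)"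
      using x r X w_nonneg has_sum_nonneg[OF has_Y] w_nonneg f_nonneg by (intro powr_ge_tangent) auto
    then have "f i * xx i * ((1 + r) * (Y / X) powr r * (w i / xx i) - r * (Y / X) powr (1 + r))
        \<le> f i * xx i * (w i / xx i) powr (1 + r)"
      using x by (intro mult_left_mono) auto
    moreover have "F * y * (p * (v / y) - q) = p * (v * F) - q * (F * y)" if "y > 0" for F y p v q :: real
      using that by (simp add: right_diff_distrib)
    note this[OF x(1)]
    ultimately have tangent: "(1 + r) * (Y / X) powr r * (w i * f i) - r * (Y / X) powr (1 + r) * (f i * xx i)
        \<le> f i * xx i * (w i / xx i) powr (1 + r)"
      by simp
    have "g1 i + g2 i - w i * V_op h \<delta> f i \<le> f i * xx i * (E * b0 / 2 - (w i / xx i) powr (1 + r) / 2)"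
      using weighted_loss_bound[OF i] unfolding g1_def g2_def E_def[symmetric] r_def[symmetric] V_op_def
      by (cases "i \<le> N") simp_all
    also have "\<dots> = E * b0 / 2 * (f i * xx i) - f i * xx i * (w i / xx i) powr (1 + r) * (1 / 2)"
      by (simp add: right_diff_distrib)
    also have "\<dots> \<le> E * b0 / 2 * (f i * xx i) -
        ((1 + r) * (Y / X) powr r * (w i * f i) - r * (Y / X) powr (1 + r) * (f i * xx i)) * (1 / 2)"
      using tangent by (intro diff_left_mono mult_right_mono) auto
    finally show "g1 i + g2 i - w i * V_op h \<delta> f i \<le> E * b0 / 2 * (f i * xx i) -
        ((1 + r) * (Y / X) powr r * (w i * f i) - r * (Y / X) powr (1 + r) * (f i * xx i)) * (1 / 2)" .
  qed
  also have "\<dots> = (E * b0 / 2 + r * (Y / X) powr (1 + r) / 2) * moment h 1 f - (1 + r) * (Y / X) powr r * Y / 2"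
  proof -
    have *: "p * m - (v - q * m) / 2 = (p + q / 2) * m - v / 2" for p m v q :: real
      by (simp add: field_simps)
    show ?thesis by (rule *)
  qed
  \<comment> \<open>The first moment has a nonnegative coefficient, so it may be raised to
    \<open>X\<close>.\<close>
  also have "\<dots> \<le> (E * b0 / 2 + r * (Y / X) powr (1 + r) / 2) * X - (1 + r) * (Y / X) powr r * Y / 2"
    using X r b0_ge c_pos by (intro diff_right_mono mult_left_mono) (auto simp: E_def)
  also have "\<dots> = X / 2 * (E * b0 - (Y / X) powr (1 + r))"
  proof -
    have "Y \<ge> 0" using has_sum_nonneg[OF has_Y] w_nonneg f_nonneg by auto
    then have "(Y / X) powr r * Y = (Y / X) powr (1 + r) * X"
      using X powr_mult_base[of "Y / X" r] by (simp add: field_simps)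
    then have "(1 + r) * (Y / X) powr r * Y = (1 + r) * ((Y / X) powr (1 + r) * X)"
      by (simp only: mult.assoc)
    then show ?thesis by (simp add: algebra_simps)
  qed
  finally show ?thesis unfolding E_def r_def .
qed

end

section \<open>Choice of the parameters and passage to the full moment\<close>

lemma powr_eventually_dominates:
  fixes p \<delta> L :: real
  assumes "p < \<delta>" "L \<ge> 0"
  obtains Z where "Z > 0" "\<And>x. x \<ge> Z \<Longrightarrow> L * x powr p \<le> x powr \<delta>"
proof
  define Z where "Z = (L + 1) powr (1 / (\<delta> - p))"
  show "Z > 0" using assms by (simp add: Z_def)
  fix x assume x: "Z \<le> x"
  have "L + 1 = Z powr (\<delta> - p)"
    using assms by (simp add: Z_def powr_powr)
  also have "\<dots> \<le> x powr (\<delta> - p)"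
    using x \<open>Z > 0\<close> assms by (intro powr_mono2) auto
  finally have "L * x powr p \<le> x powr (\<delta> - p) * x powr p"
    by (intro mult_right_mono) auto
  then show "L * x powr p \<le> x powr \<delta>"
    by (simp add: powr_add[symmetric])
qed

lemma is_solutionD:
  assumes "is_solution h \<alpha> \<beta> \<delta> \<kappa> f0 f" "t \<ge> 0"
  shows "finite_moment h 1 (f t)" "finite_moment h \<kappa> (f t)" "moment h 1 (f t) \<le> moment h 1 f0"
    "moment h \<kappa> (f t) \<le> max (moment h \<kappa> f0) (2 * B_fun (\<alpha> 1) (\<beta> 1) \<delta> \<kappa> (moment h 1 f0))"
    "\<And>i. i \<ge> 1 \<Longrightarrow> 0 \<le> f t i"
  using assms by (auto simp: is_solution_def)

text \<open>The outer exponent of \<open>B_fun\<close> is the reciprocal of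
  \<open>1 + \<delta> / (k - 1)\<close>, so the power undoes the root.\<close>

lemma B_fun_powr:
  assumes "k > 1" "\<delta> > 0" "X > 0" "C_const a b \<delta> k > 0"
  shows "(B_fun a b \<delta> k X / X) powr (1 + \<delta> / (k - 1)) =
    2 * C_const a b \<delta> k * X powr ((\<delta> + k - 1) / (\<delta> - 2 * a - b + 1))"
proof -
  define r where "r = \<delta> / (k - 1)"
  define s where "s = (\<delta> + k - 1) / (\<delta> - 2 * a - b + 1)"
  have "1 + r = (\<delta> + k - 1) / (k - 1)"
    using assms by (simp add: r_def field_simps)
  then have "(k - 1) / (\<delta> + k - 1) * (1 + r) = 1"
    using assms by simp
  note eq = this
  have "B_fun a b \<delta> k X powr (1 + r) = 2 * C_const a b \<delta> k * X powr (1 + s + r)"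
    unfolding B_fun_def powr_powr s_def[symmetric] r_def[symmetric] eq using assms by simp
  then have "(B_fun a b \<delta> k X / X) powr (1 + r) = 2 * C_const a b \<delta> k * (X powr (1 + s + r) / X powr (1 + r))"
    by (simp add: powr_divide)
  also have "X powr (1 + s + r) / X powr (1 + r) = X powr s"
    unfolding powr_diff[symmetric] by simp
  finally show ?thesis by (simp add: r_def s_def)
qed

theorem theorem2p10:
  fixes h \<delta> \<kappa> :: real and \<alpha> \<beta> :: "nat \<Rightarrow> real"
    and f0 :: "nat \<Rightarrow> real" and f :: "real \<Rightarrow> nat \<Rightarrow> real"
  assumes "h > 0"
    and "\<forall>n\<in>{1, 2, 3}. \<alpha> n > 0 \<and> \<beta> n > 0"
    and "\<delta> > 0"
    and "\<delta> > Max ((\<lambda>n. \<alpha> n + \<beta> n) ` {1, 2, 3})"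
    and "\<delta> > 2 * \<alpha> 1 + \<beta> 1 - 1"
    and "\<forall>i\<ge>1. f0 i \<ge> 0"
    and "\<kappa> > Max {\<delta>, 1, 2 - \<alpha> 1 - \<beta> 1}"
    and "finite_moment h \<kappa> f0"
    and "is_solution h \<alpha> \<beta> \<delta> \<kappa> f0 f"
  shows "\<forall>k>1. \<forall>t>0.
    finite_moment h k (f t)
    \<and> moment h k (f t)
        \<le> (2 * (k - 1) / (\<delta> * t)) powr ((k - 1) / \<delta>) * moment h 1 f0
           + B_fun (\<alpha> 1) (\<beta> 1) \<delta> k (moment h 1 f0)"
proof (intro allI impI)
  fix k t :: real
  assume k: "k > 1" and t: "t > 0"
  have pars: "\<alpha> n > 0" "\<beta> n > 0" "\<alpha> n + \<beta> n < \<delta>" if "n \<in> {1, 2, 3}" for n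
    using assms(2,4) that by auto
  have \<kappa>: "\<delta> < \<kappa>" "1 < \<kappa>"
    using assms(7) by auto
  define X where "X = moment h 1 f0"
  have prof: "profile h \<kappa> (f s)" if "s \<ge> 0" for s
    using assms(1) is_solutionD[OF assms(9) that] by unfold_locales auto
  have m1: "moment h 1 (f s) \<ge> 0" "moment h 1 (f s) \<le> X" if "s \<ge> 0" for s
    using profile.moment_nonneg[OF prof[OF that]] is_solutionD(3)[OF assms(9) that] by (simp_all add: X_def)
  have B_nonneg: "B_fun (\<alpha> 1) (\<beta> 1) \<delta> k X \<ge> 0"
    by (simp add: B_fun_def)
  interpret ft: profile h \<kappa> "f t"
    using prof t by simp
  show "finite_moment h k (f t) \<and> moment h k (f t)
      \<le> (2 * (k - 1) / (\<delta> * t)) powr ((k - 1) / \<delta>) * moment h 1 f0 + B_fun (\<alpha> 1) (\<beta> 1) \<delta> k (moment h 1 f0)"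
  \<comment> \<open>The normalization by \<open>X\<close> requires \<open>X > 0\<close>; for
    \<open>X = 0\<close> the vanishing first moment forces \<open>f t\<close> to vanish.\<close>
  proof (cases "X = 0")
    case True
    then have m0: "moment h 1 (f t) = 0"
      using m1[of t] t by simp
    have zero: "f t i * real i powr 0 = 0" if i: "i \<ge> 1" for i
    proof -
      have "sum (\<lambda>i. f t i * (real i * h) powr 1) {i} \<le> moment h 1 (f t)"
        using i ft.has_moment[of 1] ft.f_nonneg \<kappa> by (intro finite_sum_le_has_sum) auto
      then show ?thesis
        using i assms(1) ft.f_nonneg[OF i] ft.xx_pos[OF i] by (simp add: m0 mult_le_0_iff)
    qed
    have "((\<lambda>i. f t i * (real i * h) powr k) has_sum 0) {1..}"
      by (rule has_sum_0) (use zero in auto)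
    then have "finite_moment h k (f t)" "moment h k (f t) = 0"
      by (simp_all add: finite_moment_def moment_def has_sum_iff)
    then show ?thesis
      unfolding X_def[symmetric] using True B_nonneg by simp
  next
    case False
    then have X: "X > 0"
      using m1[of 0] by simp
    define e where "e = \<delta> + k - 1"
    define q where "q = \<delta> - 2 * \<alpha> 1 - \<beta> 1 + 1"
    define l where "l = (2 * \<alpha> 1 + \<beta> 1 + k - 2) / e"
    define r where "r = \<delta> / (k - 1)"
    have e: "e > 0" and q: "q > 0" and r: "r > 0"
      using k assms(3,5) by (simp_all add: e_def q_def r_def)
    have "l < 1"
      using e q by (simp add: l_def) (simp add: e_def q_def)
    then obtain c where c: "admissible c l e"
      using admissible_exists e by blast
    interpret mb: merge_bound "\<alpha> 1" "\<beta> 1" \<delta> k c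
      using pars[of 1] k c unfolding l_def e_def by unfold_locales auto
    define amp where "amp = 2 powr (\<beta> 1 + 1) * (2 powr k - 2)"
    have amp: "amp > 0"
      using mb.two_powr_k by (simp add: amp_def)
    \<comment> \<open>This solves \<open>AX\<close>, because the exponents there differ by
      \<open>q\<close>.\<close>
    define A where "A = (amp * X / c) powr (1 / q)"
    have A: "A > 0" "A powr q = amp * X / c" "A powr e = (amp * X / c) powr (e / q)"
      using amp X mb.c_pos q by (simp_all add: A_def powr_powr)
    have AX: "amp * A powr (2 * \<alpha> 1 + \<beta> 1 + k - 2) * X = c * A powr e"
    proof -
      have "2 * \<alpha> 1 + \<beta> 1 + k - 2 + q = e"
        by (simp add: e_def q_def)
      then have "A powr e = A powr (2 * \<alpha> 1 + \<beta> 1 + k - 2) * A powr q"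
        unfolding powr_add[symmetric] by simp
      then show ?thesis
        using mb.c_pos by (simp add: A(2))
    qed
    define \<beta>' where "\<beta>' = B_fun (\<alpha> 1) (\<beta> 1) \<delta> k X / X"
    \<comment> \<open>The equilibrium of the differential inequality is \<open>\<beta>'\<close>: the
      parameter \<open>c\<close> cancels between the threshold \<open>A\<close> and
      \<open>b0\<close>.\<close>
    have stationary: "A powr e * mb.b0 = \<beta>' powr (1 + r)"
    proof -
      have b0: "2 * C_const (\<alpha> 1) (\<beta> 1) \<delta> k * (c / amp) powr (e / q) = mb.b0"
        unfolding amp_def e_def q_def mb.b0_def
        by (rule C_const_young_const) (use k q e mb.c_pos in \<open>simp_all add: e_def q_def\<close>)
      have "mb.b0 > 0" using mb.b0_ge mb.c_pos by linarith
      then have C: "C_const (\<alpha> 1) (\<beta> 1) \<delta> k > 0"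
        unfolding b0[symmetric] by (simp add: zero_less_mult_iff)
      have "A powr e * mb.b0 = 2 * C_const (\<alpha> 1) (\<beta> 1) \<delta> k * ((amp * X / c) powr (e / q) * (c / amp) powr (e / q))"
        unfolding b0[symmetric] A(3) by simp
      also have "(amp * X / c) powr (e / q) * (c / amp) powr (e / q) = X powr (e / q)"
        unfolding powr_mult[symmetric] using amp mb.c_pos by simp
      finally show ?thesis
        using B_fun_powr[OF k assms(3) X C] by (simp add: \<beta>'_def r_def e_def q_def)
    qed
    define K where "K = max (moment h \<kappa> f0) (2 * B_fun (\<alpha> 1) (\<beta> 1) \<delta> \<kappa> X)"
    have K: "K \<ge> 0"
      by (simp add: K_def B_fun_def le_max_iff_disj)
    \<comment> \<open>The factor \<open>4\<close> lets each of the two splitting operators take a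
      quarter of \<open>x powr \<delta>\<close>, together the half allowed by \<open>tail\<close>.
      As \<open>K\<close> bounds the moment of order \<kappa> at all times, \<open>Z\<close> is
      independent of time.\<close>
    have "\<exists>Z. \<forall>x\<ge>Z. 4 * (h powr (\<alpha> n - \<kappa>) * K) * x powr (\<alpha> n + \<beta> n) \<le> x powr \<delta>" if "n \<in> {1, 2, 3}" for n
    proof -
      have "4 * (h powr (\<alpha> n - \<kappa>) * K) \<ge> 0"
        using K by simp
      from powr_eventually_dominates[OF pars(3)[OF that] this] show ?thesis
        by blast
    qed
    then obtain Z where Z: "\<And>n x. n \<in> {1, 2, 3} \<Longrightarrow> x \<ge> Z n \<Longrightarrow>
        4 * (h powr (\<alpha> n - \<kappa>) * K) * x powr (\<alpha> n + \<beta> n) \<le> x powr \<delta>"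
      using bchoice[of "{1, 2, 3 :: nat}" "\<lambda>n Z. \<forall>x\<ge>Z. 4 * (h powr (\<alpha> n - \<kappa>) * K) * x powr (\<alpha> n + \<beta> n) \<le> x powr \<delta>"]
      by blast
    obtain N0 :: nat where N0: "max A (max (Z 2) (Z 3)) / h \<le> real N0"
      using real_arch_simple by blast
    then have N0': "A \<le> real N0 * h" "Z 2 \<le> real N0 * h" "Z 3 \<le> real N0 * h"
      using assms(1) by (simp_all add: pos_divide_le_eq)
    have tm: "truncated_moment (\<alpha> 1) (\<beta> 1) \<delta> k c h \<kappa> (f s) X A (\<alpha> 2) (\<beta> 2) (\<alpha> 3) (\<beta> 3) N"
      if N: "N \<ge> N0" and s: "s \<ge> 0" for N s
    proof (intro truncated_moment.intro truncated_moment_axioms.intro)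
      interpret fs: profile h \<kappa> "f s" using prof[OF s] .
      have m: "moment h (\<alpha> n) (f s) * x powr (\<alpha> n + \<beta> n) \<le> x powr \<delta> / 4" if "n \<in> {1, 2, 3}" "Z n \<le> x" for n x
      proof -
        have "moment h (\<alpha> n) (f s) \<le> h powr (\<alpha> n - \<kappa>) * moment h \<kappa> (f s)"
          using pars[OF that(1)] \<kappa> by (intro fs.moment_le) simp
        also have "\<dots> \<le> h powr (\<alpha> n - \<kappa>) * K"
          using is_solutionD(4)[OF assms(9) s] by (intro mult_left_mono) (auto simp: K_def X_def)
        finally have "moment h (\<alpha> n) (f s) * x powr (\<alpha> n + \<beta> n) \<le> h powr (\<alpha> n - \<kappa>) * K * x powr (\<alpha> n + \<beta> n)"
          by (intro mult_right_mono) auto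
        then show ?thesis using Z[OF that] by simp
      qed
      have NN: "real N0 * h \<le> real N * h"
        using N assms(1) by (intro mult_right_mono) auto
      then show "A \<le> real N * h" using N0'(1) by linarith
      fix i assume "N < i"
      then have "real N * h \<le> real i * h"
        using assms(1) by (intro mult_right_mono) auto
      then have "Z 2 \<le> real i * h" "Z 3 \<le> real i * h"
        using NN N0'(2,3) by linarith+
      then have "moment h (\<alpha> 2) (f s) * (real i * h) powr (\<alpha> 2 + \<beta> 2) \<le> (real i * h) powr \<delta> / 4"
        "moment h (\<alpha> 3) (f s) * (real i * h) powr (\<alpha> 3 + \<beta> 3) \<le> (real i * h) powr \<delta> / 4"
        using m by blast+
      then show "moment h (\<alpha> 2) (f s) * (real i * h) powr (\<alpha> 2 + \<beta> 2)
          + moment h (\<alpha> 3) (f s) * (real i * h) powr (\<alpha> 3 + \<beta> 3) \<le> (real i * h) powr \<delta> / 2"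
        by linarith
    qed (use prof[OF s] mb.merge_bound_axioms pars[of 2] pars[of 3] \<kappa> X m1[OF s] A(1) AX in \<open>simp_all add: amp_def e_def\<close>)
    define T where "T = (2 * (k - 1) / (\<delta> * t)) powr ((k - 1) / \<delta>) * X + B_fun (\<alpha> 1) (\<beta> 1) \<delta> k X"
    have truncated: "(\<Sum>\<^sub>\<infinity>i\<in>{1..}. test_fun k A (real (min i N) * h) * f t i) \<le> T" if N: "N \<ge> N0" for N
    proof -
      define w where "w i = test_fun k A (real (min i N) * h)" for i
      define Y where "Y s = (\<Sum>\<^sub>\<infinity>i\<in>{1..}. w i * f s i)" for s
      define Y' where "Y' s = (\<Sum>\<^sub>\<infinity>i\<in>{1..}. w i * O_op h \<alpha> \<beta> \<delta> (f s) i)" for s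
      have Y_der: "(Y has_real_derivative Y' s) (at s)" if s: "s > 0" for s
      proof -
        interpret tm: truncated_moment "\<alpha> 1" "\<beta> 1" \<delta> k c h \<kappa> "f s" X A "\<alpha> 2" "\<beta> 2" "\<alpha> 3" "\<beta> 3" N
          using tm[OF N] s by simp
        have "tm.w = w"
          by (simp add: fun_eq_iff tm.w_def w_def)
        then have w_abs_le: "\<bar>w i\<bar> \<le> w N" for i
          using tm.w_abs_le[of i] by simp
        have "C1_l1 f (\<lambda>t. O_op h \<alpha> \<beta> \<delta> (f t))"
          using assms(9) by (simp add: is_solution_def)
        from bounded_weight_has_derivative[OF this w_abs_le s] show ?thesis
          unfolding Y_def Y'_def .
      qed
      have Y'_le: "Y' s \<le> X / 2 * (\<beta>' powr (1 + r) - (Y s / X) powr (1 + r))" if s: "s > 0" for s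
      proof -
        interpret tm: truncated_moment "\<alpha> 1" "\<beta> 1" \<delta> k c h \<kappa> "f s" X A "\<alpha> 2" "\<beta> 2" "\<alpha> 3" "\<beta> 3" N
          using tm[OF N] s by simp
        have w: "tm.w = w"
          by (simp add: fun_eq_iff tm.w_def w_def)
        have "Y' s = (\<Sum>\<^sub>\<infinity>i\<in>{1..}. w i * (S_merge h (\<alpha> 1) (\<beta> 1) (f s) i + S_split h (\<alpha> 2) (\<beta> 2) (f s) i
            + S_split h (\<alpha> 3) (\<beta> 3) (f s) i - V_op h \<delta> (f s) i))"
          by (simp add: Y'_def O_op_def S_op_def)
        then show ?thesis
          using tm.weighted_operator_le stationary unfolding w tm.Y_def Y_def[symmetric] e_def r_def by simp
      qed
      have "Y t / X \<le> (2 / (r * t)) powr (1 / r) + \<beta>'"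
      proof (rule powr_decay_ode[where u' = "\<lambda>s. Y' s / X", OF r _ _ _ t])
        show "\<beta>' \<ge> 0" using B_nonneg X by (simp add: \<beta>'_def)
        show "((\<lambda>s. Y s / X) has_real_derivative Y' s / X) (at s)" if "s > 0" for s
          using Y_der[OF that] by (rule DERIV_cdivide)
        show "Y' s / X \<le> (\<beta>' powr (1 + r) - (Y s / X) powr (1 + r)) / 2" if "s > 0" for s
          using divide_right_mono[OF Y'_le[OF that], of X] X by simp
      qed
      then have "Y t \<le> ((2 / (r * t)) powr (1 / r) + \<beta>') * X"
        using X by (simp add: pos_divide_le_eq)
      also have "\<dots> = T"
        using X k assms(3) by (simp add: T_def \<beta>'_def r_def distrib_right)
      finally show ?thesis by (simp add: Y_def w_def)
    qed
    \<comment> \<open>Since \<open>T\<close> does not depend on \<open>N\<close>, the truncation can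
      be pushed beyond any finite set of sizes. This also gives finiteness of the moment for every
      \<open>k\<close>, even above \<kappa>.\<close>
    have partial: "(\<Sum>i\<in>F. f t i * (real i * h) powr k) \<le> T" if F: "finite F" "F \<subseteq> {1..}" for F
    proof -
      obtain M where M: "\<forall>i\<in>F. i \<le> M"
        using F(1) finite_nat_set_iff_bounded_le by auto
      define N where "N = max N0 M"
      interpret tm: truncated_moment "\<alpha> 1" "\<beta> 1" \<delta> k c h \<kappa> "f t" X A "\<alpha> 2" "\<beta> 2" "\<alpha> 3" "\<beta> 3" N
        using tm[of N0 t] tm[of N t] t by (simp add: N_def)
      have "(\<Sum>i\<in>F. f t i * (real i * h) powr k) \<le> (\<Sum>i\<in>F. tm.w i * f t i)"
      proof (rule sum_mono)
        fix i assume "i \<in> F"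
        then have i: "i \<ge> 1" "i \<le> N" using F M by (auto simp: N_def)
        have "(real i * h) powr k \<le> tm.w i"
          using powr_le_test_fun[of "real i * h" k A] k A(1) assms(1) by (simp add: tm.w_small[OF i(2)])
        then show "f t i * (real i * h) powr k \<le> tm.w i * f t i"
          unfolding mult.commute[of "tm.w i"] using ft.f_nonneg[OF i(1)] by (intro mult_left_mono) auto
      qed
      also have "\<dots> \<le> tm.Y"
        using F tm.w_nonneg ft.f_nonneg by (intro finite_sum_le_has_sum[OF tm.has_Y]) auto
      also have "\<dots> \<le> T"
        unfolding tm.Y_def tm.w_def by (rule truncated) (simp add: N_def)
      finally show ?thesis .
    qed
    have "(\<lambda>i. f t i * (real i * h) powr k) summable_on {1..}"
      using partial ft.f_nonneg by (intro nonneg_bdd_above_summable_on bdd_aboveI2[where M = T]) auto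
    then show ?thesis
      using infsum_le_finite_sums[OF _ partial] by (simp add: finite_moment_def moment_def T_def X_def)
  qed
qed

end
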